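(* There exist universal constants $c,c'>0$ and $d_0\in\mathbb N$ such that the following holds. If $d\ge d_0$, $n\in\mathbb N$, $\xi\in(0,1/e)$ and $\alpha>0$ satisfy $$c\sqrt{\frac{\log d}{n}}\le\alpha\le\min\left\{c\cdot\frac{d^{0.49}}{n\sqrt{\log(1/\xi)}},\ \frac18\right\},$$ then there exists an $\ell_1$ SCO problem $\mathcal P\in\mathcal L_1^d$ such that every $\alpha$-learner $\mathcal A_n$ for $\mathcal P$ (using $n$ samples) is $(\xi,m)$-traceable for some $m\ge c'\log(d)/\alpha^2$ (i.e. $m\in\Omega(\log(d)/\alpha^2)$).
   Context: $\mathcal M_1(\mathcal R)$ denotes the set of probability measures on a measurable space $\mathcal R$, and $\mathcal B_1(r)=\{\theta\in\mathbb R^d:\|\theta\|_1\le r\}$. An SCO problem in dimension $d$ is a triple $\mathcal P=(\Theta,\mathcal Z,f)$ with $\mathcal Z$ a measurable data space, $\Theta\subset\mathbb R^d$ convex, and $f:\Theta\times\mathcal Z\to\mathbb R$ with $f(\cdot,z)$ convex for every $z\in\mathcal Z$. For $\mathcal D\in\mathcal M_1(\mathcal Z)$, let $F_{\mathcal D}(\theta)=\mathbb E_{Z\sim\mathcal D}[f(\theta,Z)]$. A (randomized) learning algorithm is a map $\mathcal A_n:\mathcal Z^n\to\mathcal M_1(\Theta)$; it is an $\alpha$-learner for $\mathcal P$ if for every $\mathcal D\in\mathcal M_1(\mathcal Z)$, $\mathbb E_{S_n\sim\mathcal D^{\otimes n},\hat\theta\sim\mathcal A_n(S_n)}[F_{\mathcal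 D}(\hat\theta)]-\inf_{\theta\in\Theta}F_{\mathcal D}(\theta)\le\alpha$. $\mathcal L_1^d$ ($\ell_1$ SCO problems) is the set of SCO problems $(\Theta,\mathcal Z,f)$ in dimension $d$ with $\Theta\subset\mathcal B_1(1)$ and $|f(\theta_1,z)-f(\theta_2,z)|\le\|\theta_1-\theta_2\|_1$ for all $\theta_1,\theta_2\in\Theta$, $z\in\mathcal Z$. Tracing: a tracer is a pair $(\phi,\mathcal D)$ with $\phi:\Theta\times\mathcal Z\to\mathbb R$ measurable and $\mathcal D\in\mathcal M_1(\mathcal Z)$. An algorithm $\mathcal A_n$ is $(\xi,m)$-traceable ($\xi\in(0,1)$, $m$ a real number) if there exist a tracer $(\phi,\mathcal D)$ and $\lambda\in\mathbb R$ such that, if $(Z_0,Z_1,\dots,Z_n)\sim\mathcal D^{\otimes(n+1)}$ and $\hat\theta\sim\mathcal A_n(Z_1,\dots,Z_n)$ (independently of $Z_0$ given the sample), then (i) $\Pr(\phi(\hat\theta,Z_0)\ge\lambda)\le\xi$, and (ii) $\mathbb E\big[|\{i\in[n]:\phi(\hat\theta,Z_i)\ge\lambda\}|\big]\ge m$. *)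

theory Defs
  imports "HOL-Probability.Probability"
begin

text \<open>
  The dimension \<open>d\<close> is quantified inside the theorem, below the universal constants, so
  \<open>\<real>\<^sup>d\<close> is the carrier of the product space: functions on \<open>{..<d}\<close>, extended by \<open>undefined\<close>,
  with the Borel \<open>\<sigma>\<close>-algebra.
\<close>

type_synonym rvec = "nat \<Rightarrow> real"

definition euclid :: "nat \<Rightarrow> rvec measure" where
  "euclid d = (\<Pi>\<^sub>M i\<in>{..<d}. borel)"

definition l1_norm :: "nat \<Rightarrow> rvec \<Rightarrow> real" where
  "l1_norm d x = (\<Sum>i<d. \<bar>x i\<bar>)"

definition l1_dist :: "nat \<Rightarrow> rvec \<Rightarrow> rvec \<Rightarrow> real" where
  "l1_dist d x y = l1_norm d (\<lambda>i\<in>{..<d}. x i - y i)"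

definition l1_ball :: "nat \<Rightarrow> real \<Rightarrow> rvec set" where
  "l1_ball d r = {x \<in> space (euclid d). l1_norm d x \<le> r}"

definition conv_comb :: "nat \<Rightarrow> real \<Rightarrow> rvec \<Rightarrow> rvec \<Rightarrow> rvec" where
  "conv_comb d t x y = (\<lambda>i\<in>{..<d}. (1 - t) * x i + t * y i)"

definition convex_set :: "nat \<Rightarrow> rvec set \<Rightarrow> bool" where
  "convex_set d \<Theta> \<longleftrightarrow> (\<forall>x\<in>\<Theta>. \<forall>y\<in>\<Theta>. \<forall>t\<in>{0..1}. conv_comb d t x y \<in> \<Theta>)"

definition convex_fun_on :: "nat \<Rightarrow> rvec set \<Rightarrow> (rvec \<Rightarrow> real) \<Rightarrow> bool" where
  "convex_fun_on d \<Theta> g \<longleftrightarrow>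
     (\<forall>x\<in>\<Theta>. \<forall>y\<in>\<Theta>. \<forall>t\<in>{0..1}. g (conv_comb d t x y) \<le> (1 - t) * g x + t * g y)"

text \<open>
  A measurable space is represented by a measure, of which only the carrier and the
  \<open>\<sigma>\<close>-algebra are used; \<open>\<M>\<^sub>1(\<R>)\<close> is \<open>space (prob_algebra R)\<close>.
  The parameter set carries the trace of the Borel \<open>\<sigma>\<close>-algebra of \<open>\<real>\<^sup>d\<close>.
\<close>

definition param_space :: "nat \<Rightarrow> rvec set \<Rightarrow> rvec measure" where
  "param_space d \<Theta> = restrict_space (euclid d) \<Theta>"

type_synonym 'z sco = "rvec set \<times> 'z measure \<times> (rvec \<Rightarrow> 'z \<Rightarrow> real)"

text \<open>
  The measurability and integrability conditions say that the expectation
  \<open>F\<^sub>\<D>(\<theta>)\<close> exists for every \<open>\<D>\<close> and \<open>\<theta>\<close>. Without \<open>\<Theta> \<noteq> {}\<close>, the infimum of \<open>F\<^sub>\<D>\<close> would be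
  meaningless, and there would be no learner at all.
\<close>

definition sco_problem :: "nat \<Rightarrow> 'z sco \<Rightarrow> bool" where
  "sco_problem d = (\<lambda>(\<Theta>, Z, f).
     \<Theta> \<subseteq> space (euclid d) \<and> \<Theta> \<noteq> {} \<and> convex_set d \<Theta> \<and>
     (\<forall>z\<in>space Z. convex_fun_on d \<Theta> (\<lambda>\<theta>. f \<theta> z)) \<and>
     (\<forall>\<theta>\<in>\<Theta>. f \<theta> \<in> borel_measurable Z) \<and>
     (\<forall>D\<in>space (prob_algebra Z). \<forall>\<theta>\<in>\<Theta>. integrable D (f \<theta>)))"

definition l1_sco :: "nat \<Rightarrow> 'z sco set" where
  "l1_sco d = {(\<Theta>, Z, f). sco_problem d (\<Theta>, Z, f) \<and> \<Theta> \<subseteq> l1_ball d 1 \<and>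
     (\<forall>\<theta>1\<in>\<Theta>. \<forall>\<theta>2\<in>\<Theta>. \<forall>z\<in>space Z. \<bar>f \<theta>1 z - f \<theta>2 z\<bar> \<le> l1_dist d \<theta>1 \<theta>2)}"

definition pop_risk :: "(rvec \<Rightarrow> 'z \<Rightarrow> real) \<Rightarrow> 'z measure \<Rightarrow> rvec \<Rightarrow> real" where
  "pop_risk f D \<theta> = (\<integral>z. f \<theta> z \<partial>D)"

text \<open>
  Randomized algorithms are Markov kernels; samples are indexed by \<open>{1..n}\<close>, the index \<open>0\<close>
  being that of the fresh point \<open>Z\<^sub>0\<close> in \<open>tracing_law\<close>.
\<close>

definition algorithms :: "nat \<Rightarrow> nat \<Rightarrow> 'z sco \<Rightarrow> ((nat \<Rightarrow> 'z) \<Rightarrow> rvec measure) set" where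
  "algorithms d n = (\<lambda>(\<Theta>, Z, f).
     (\<Pi>\<^sub>M i\<in>{1..n}. Z) \<rightarrow>\<^sub>M prob_algebra (param_space d \<Theta>))"

definition is_learner ::
  "nat \<Rightarrow> nat \<Rightarrow> real \<Rightarrow> 'z sco \<Rightarrow> ((nat \<Rightarrow> 'z) \<Rightarrow> rvec measure) \<Rightarrow> bool" where
  "is_learner d n \<alpha> = (\<lambda>(\<Theta>, Z, f) A.
     A \<in> algorithms d n (\<Theta>, Z, f) \<and>
     (\<forall>D\<in>space (prob_algebra Z).
        (\<integral>S. (\<integral>\<theta>. pop_risk f D \<theta> \<partial>A S) \<partial>(\<Pi>\<^sub>M i\<in>{1..n}. D)) - (INF \<theta>\<in>\<Theta>. pop_risk f D \<theta>) \<le> \<alpha>))"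

text \<open>Joint law of \<open>((Z\<^sub>0, \<dots>, Z\<^sub>n), \<theta>)\<close> where \<open>\<theta>\<close> is the output of \<open>A\<close> on \<open>(Z\<^sub>1, \<dots>, Z\<^sub>n)\<close>.\<close>

definition tracing_law :: "nat \<Rightarrow> nat \<Rightarrow> rvec set \<Rightarrow> 'z measure \<Rightarrow>
    ((nat \<Rightarrow> 'z) \<Rightarrow> rvec measure) \<Rightarrow> ((nat \<Rightarrow> 'z) \<times> rvec) measure" where
  "tracing_law d n \<Theta> D A =
     do { z \<leftarrow> (\<Pi>\<^sub>M i\<in>{0..n}. D);
          \<theta> \<leftarrow> A (restrict z {1..n});
          return ((\<Pi>\<^sub>M i\<in>{0..n}. D) \<Otimes>\<^sub>M param_space d \<Theta>) (z, \<theta>) }"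

definition is_tracer ::
  "nat \<Rightarrow> 'z sco \<Rightarrow> (rvec \<Rightarrow> 'z \<Rightarrow> real) \<Rightarrow> 'z measure \<Rightarrow> bool" where
  "is_tracer d = (\<lambda>(\<Theta>, Z, f) \<phi> D.
     case_prod \<phi> \<in> borel_measurable (param_space d \<Theta> \<Otimes>\<^sub>M Z) \<and> D \<in> space (prob_algebra Z))"

definition traceable :: "nat \<Rightarrow> nat \<Rightarrow> real \<Rightarrow> real \<Rightarrow> 'z sco \<Rightarrow>
    ((nat \<Rightarrow> 'z) \<Rightarrow> rvec measure) \<Rightarrow> bool" where
  "traceable d n \<xi> m = (\<lambda>(\<Theta>, Z, f) A.
     0 < \<xi> \<and> \<xi> < 1 \<and>
     (\<exists>\<phi> D lam. is_tracer d (\<Theta>, Z, f) \<phi> D \<and>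
        \<P>((z, \<theta>) in tracing_law d n \<Theta> D A. lam \<le> \<phi> \<theta> (z 0)) \<le> \<xi> \<and>
        m \<le> (\<integral>(z, \<theta>). real (card {i\<in>{1..n}. lam \<le> \<phi> \<theta> (z i)}) \<partial>tracing_law d n \<Theta> D A)))"

end

theory Submission
  imports Defs "HOL-Probability.Hoeffding" "HOL-Real_Asymp.Real_Asymp"
begin

text \<open>
  The coordinates are divided into \<open>s\<close> blocks of size \<open>k\<close> (with \<open>s\<close> nearly \<open>d\<close> and \<open>k\<close> a small power
  of \<open>d\<close>). A parameter splits mass \<open>1 / s\<close> within each block, the data are sign vectors, and the loss is
  \<open>- \<langle>\<theta>, z\<rangle>\<close>, so that a learner has to find the best of \<open>k\<close> experts in most blocks.

  If the coordinate means are drawn from a truncated geometric prior of scale \<open>\<alpha> / log k\<close>, a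
  fingerprinting argument (summation by parts against the prior) shows that for some choice of the means
  the output has total correlation of order \<open>log k / \<alpha>\<close> with the centred sample points. A fresh point
  has correlation at most \<open>\<surd>(log (1 / \<xi>) / s)\<close> except with probability \<open>\<xi>\<close>, and \<open>n\<close> times this threshold is
  negligible. Uniformly over all parameters, the parts of the correlations exceeding a large multiple
  of \<open>\<alpha>\<close> add up to only a small fraction of \<open>log k / \<alpha>\<close>. Hence the total must come from order \<open>log k / \<alpha>\<^sup>2\<close>
  sample points above the threshold.
\<close>

section \<open>Expectations over finite products\<close>

text \<open>With a single block the output could be one vertex, and a fresh sign would score as high
  as a sample point with constant probability; no small \<xi> could be reached. Feasibility in
  \<open>s\<close> blocks caps every coordinate at \<open>1 / s\<close>, so a fresh score is
  sub-Gaussian with variance of order \<open>1 / s\<close>, while each block still poses a selection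
  problem among \<open>k\<close> coordinates. The exponent 0.49 leaves room for \<open>k\<close> to
  be a power of \<open>d\<close>: it suffices that \<open>s\<close> is at least
  \<open>d powr 0.98\<close>.

  Fingerprinting bounds only the sum of the correlations, which a few sample points might carry
  alone. The output depends on the sample, so concentration for a fixed parameter does not exclude
  this; hence a bound through all vertices at once. Its cost \<open>(n + s * ln k) / s\<close> is of
  order \<open>ln k\<close> because the two bounds on \<alpha> together force
  \<open>n \<le> s\<close>.

  The problem does not depend on the learner; the means, and with them the tracer, are chosen after
  it. The data space is finite, so expectations over the data and the prior are finite sums.\<close>

text \<open>One notion serves three laws: the coordinates of a sign vector, the sample of
  \<open>n\<close> sign vectors, and the random levels that determine the means.\<close>

definition pexp :: "'i set \<Rightarrow> 'x set \<Rightarrow> ('i \<Rightarrow> 'x \<Rightarrow> real) \<Rightarrow> (('i \<Rightarrow> 'x) \<Rightarrow> real) \<Rightarrow> real" where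
  "pexp I X p F = (\<Sum>x\<in>I \<rightarrow>\<^sub>E X. (\<Prod>i\<in>I. p i (x i)) * F x)"

lemma pexp_cong:
  assumes "\<And>x. x \<in> I \<rightarrow>\<^sub>E X \<Longrightarrow> F x = G x"
  shows "pexp I X p F = pexp I X p G"
  unfolding pexp_def using assms by (intro sum.cong) auto

lemma pexp_add: "pexp I X p (\<lambda>x. F x + G x) = pexp I X p F + pexp I X p G"
  unfolding pexp_def by (simp add: distrib_left sum.distrib)

lemma pexp_diff: "pexp I X p (\<lambda>x. F x - G x) = pexp I X p F - pexp I X p G"
  unfolding pexp_def by (simp add: right_diff_distrib sum_subtractf)

lemma pexp_cmult: "pexp I X p (\<lambda>x. c * F x) = c * pexp I X p F"
  unfolding pexp_def by (simp add: sum_distrib_left mult.left_commute)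

lemma pexp_sum: "pexp I X p (\<lambda>x. \<Sum>a\<in>A. F a x) = (\<Sum>a\<in>A. pexp I X p (F a))"
  unfolding pexp_def sum_distrib_left by (rule sum.swap)

lemma pexp_mono:
  assumes "\<And>i x. i \<in> I \<Longrightarrow> x \<in> X \<Longrightarrow> 0 \<le> p i x" and "\<And>x. x \<in> I \<rightarrow>\<^sub>E X \<Longrightarrow> F x \<le> G x"
  shows "pexp I X p F \<le> pexp I X p G"
  unfolding pexp_def using assms by (intro sum_mono mult_left_mono prod_nonneg) (auto simp: PiE_mem)

lemma pexp_prod:
  assumes "finite I" "finite X"
  shows "pexp I X p (\<lambda>x. \<Prod>i\<in>I. f i (x i)) = (\<Prod>i\<in>I. \<Sum>y\<in>X. p i y * f i y)"
  unfolding pexp_def using assms by (simp add: prod_sum_PiE prod.distrib)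

lemma pexp_const:
  assumes "finite I" "finite X" "\<And>i. i \<in> I \<Longrightarrow> (\<Sum>x\<in>X. p i x) = 1"
  shows "pexp I X p (\<lambda>_. c) = c"
proof -
  have "pexp I X p (\<lambda>_. 1) = 1"
    using pexp_prod[OF assms(1,2), of p "\<lambda>_ _. 1"] assms(3) by simp
  then show ?thesis using pexp_cmult[of I X p c "\<lambda>_. 1"] by simp
qed

lemma pexp_insert:
  assumes "finite I" "finite X" "j \<notin> I"
  shows "pexp (insert j I) X p F = (\<Sum>y\<in>X. p j y * pexp I X p (\<lambda>x. F (x(j := y))))"
proof -
  have inj: "inj_on (\<lambda>(y, g). g(j := y)) (X \<times> (I \<rightarrow>\<^sub>E X))"
    using assms(3) by (rule inj_combinator)
  have "pexp (insert j I) X p F =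
      (\<Sum>(y, g)\<in>X \<times> (I \<rightarrow>\<^sub>E X). (\<Prod>i\<in>insert j I. p i ((g(j := y)) i)) * F (g(j := y)))"
    unfolding pexp_def PiE_insert_eq sum.reindex[OF inj]
    by (intro sum.cong) auto
  also have "\<dots> = (\<Sum>(y, g)\<in>X \<times> (I \<rightarrow>\<^sub>E X). p j y * ((\<Prod>i\<in>I. p i (g i)) * F (g(j := y))))"
  proof (intro sum.cong refl, clarify)
    fix y g
    have "(\<Prod>i\<in>I. p i ((g(j := y)) i)) = (\<Prod>i\<in>I. p i (g i))"
      using assms(3) by (intro prod.cong) auto
    then show "(\<Prod>i\<in>insert j I. p i ((g(j := y)) i)) * F (g(j := y)) =
        p j y * ((\<Prod>i\<in>I. p i (g i)) * F (g(j := y)))"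
      using assms by simp
  qed
  also have "\<dots> = (\<Sum>y\<in>X. p j y * pexp I X p (\<lambda>x. F (x(j := y))))"
    unfolding pexp_def sum_distrib_left by (rule sum.cartesian_product[symmetric])
  finally show ?thesis .
qed

lemma pexp_split:
  assumes "finite I" "finite X" "j \<in> I"
  shows "pexp I X p F = (\<Sum>y\<in>X. p j y * pexp (I - {j}) X p (\<lambda>x. F (x(j := y))))"
  using pexp_insert[of "I - {j}" X j p F] assms by (simp add: insert_absorb)

text \<open>The averaging argument that later extracts one choice of the means from the prior.
  Strictness comes from a point of nonzero weight, which exists because the weights sum to
  one.\<close>

lemma pexp_exists_ge:
  assumes "finite I" "finite X" "\<And>i. i \<in> I \<Longrightarrow> (\<Sum>x\<in>X. p i x) = 1"
    and "\<And>i x. i \<in> I \<Longrightarrow> x \<in> X \<Longrightarrow> 0 \<le> p i x" and "c \<le> pexp I X p F"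
  shows "\<exists>x\<in>I \<rightarrow>\<^sub>E X. c \<le> F x"
proof (rule ccontr)
  assume "\<not> ?thesis"
  then have lt: "\<And>x. x \<in> I \<rightarrow>\<^sub>E X \<Longrightarrow> F x < c" by force
  have fin: "finite (I \<rightarrow>\<^sub>E X)" using assms by (intro finite_PiE) auto
  have tot: "(\<Sum>x\<in>I \<rightarrow>\<^sub>E X. \<Prod>i\<in>I. p i (x i)) = 1"
    using pexp_const[of I X p 1] assms by (simp add: pexp_def)
  obtain x0 where x0: "x0 \<in> I \<rightarrow>\<^sub>E X" "(\<Prod>i\<in>I. p i (x0 i)) \<noteq> 0"
    using tot by (metis (no_types, lifting) sum.neutral zero_neq_one)
  have nn: "0 \<le> (\<Prod>i\<in>I. p i (x i))" if "x \<in> I \<rightarrow>\<^sub>E X" for x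
    using assms(4) that by (intro prod_nonneg) (auto simp: PiE_mem)
  have "pexp I X p F < pexp I X p (\<lambda>_. c)"
    unfolding pexp_def
  proof (rule sum_strict_mono_ex1[OF fin])
    show "\<forall>x\<in>I \<rightarrow>\<^sub>E X. (\<Prod>i\<in>I. p i (x i)) * F x \<le> (\<Prod>i\<in>I. p i (x i)) * c"
      using nn lt[THEN less_imp_le] by (intro ballI mult_left_mono)
    show "\<exists>x\<in>I \<rightarrow>\<^sub>E X. (\<Prod>i\<in>I. p i (x i)) * F x < (\<Prod>i\<in>I. p i (x i)) * c"
    proof (rule bexI[OF _ x0(1)])
      have "0 < (\<Prod>i\<in>I. p i (x0 i))" using x0(2) nn[OF x0(1)] by linarith
      then show "(\<Prod>i\<in>I. p i (x0 i)) * F x0 < (\<Prod>i\<in>I. p i (x0 i)) * c"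
        using lt[OF x0(1)] by (rule mult_strict_left_mono[rotated])
    qed
  qed
  then show False using assms pexp_const[of I X p c] by simp
qed

text \<open>Both sides are determined by their values on boxes, where the sum of products factors.
  This is the bridge from integrals over samples to \<open>pexp\<close>.\<close>

lemma PiM_point_measure:
  fixes p :: "'x \<Rightarrow> real"
  assumes I: "finite I" and X: "finite X" and p: "\<And>x. x \<in> X \<Longrightarrow> 0 \<le> p x"
  shows "(\<Pi>\<^sub>M i\<in>I. point_measure X p) = point_measure (I \<rightarrow>\<^sub>E X) (\<lambda>x. \<Prod>i\<in>I. p (x i))"
proof -
  have fm: "finite_measure (point_measure X p)"
    using X by (intro finite_measureI) (simp add: space_point_measure emeasure_point_measure_finite)
  interpret product_sigma_finite "\<lambda>i. point_measure X p"
    using fm by (simp add: product_sigma_finite_def finite_measure.sigma_finite_measure)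
  have finP: "finite (I \<rightarrow>\<^sub>E X)" using I X by (intro finite_PiE) auto
  show ?thesis
  proof (rule PiM_eqI[OF I, symmetric])
    have "sets (\<Pi>\<^sub>M i\<in>I. point_measure X p) = sets (\<Pi>\<^sub>M i\<in>I. count_space X)"
      by (intro sets_PiM_cong) (auto simp: sets_point_measure)
    also have "\<dots> = sets (count_space (I \<rightarrow>\<^sub>E X))"
      using count_space_PiM_finite[OF I, of "\<lambda>_. X"] X by (simp add: countable_finite)
    finally show "sets (point_measure (I \<rightarrow>\<^sub>E X) (\<lambda>x. \<Prod>i\<in>I. p (x i))) =
        sets (\<Pi>\<^sub>M i\<in>I. point_measure X p)" by (simp add: sets_point_measure)
  next
    fix A :: "'a \<Rightarrow> 'x set" assume "\<And>i. i \<in> I \<Longrightarrow> A i \<in> sets (point_measure X p)"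
    then have A: "\<And>i. i \<in> I \<Longrightarrow> A i \<subseteq> X" by (auto simp: sets_point_measure)
    have sub: "Pi\<^sub>E I A \<subseteq> I \<rightarrow>\<^sub>E X" using A by (intro PiE_mono) auto
    have fA: "\<And>i. i \<in> I \<Longrightarrow> finite (A i)" using A X finite_subset by blast
    have "emeasure (point_measure (I \<rightarrow>\<^sub>E X) (\<lambda>x. \<Prod>i\<in>I. p (x i))) (Pi\<^sub>E I A) =
        (\<Sum>x\<in>Pi\<^sub>E I A. ennreal (\<Prod>i\<in>I. p (x i)))"
      using finP sub by (simp add: emeasure_point_measure_finite)
    also have "\<dots> = (\<Sum>x\<in>Pi\<^sub>E I A. \<Prod>i\<in>I. ennreal (p (x i)))"
      using A p by (intro sum.cong refl prod_ennreal[symmetric]) (auto simp: PiE_mem subset_iff)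
    also have "\<dots> = (\<Prod>i\<in>I. \<Sum>x\<in>A i. ennreal (p x))"
      using I fA by (simp add: prod_sum_PiE)
    also have "\<dots> = (\<Prod>i\<in>I. emeasure (point_measure X p) (A i))"
      using A X by (intro prod.cong refl) (simp add: emeasure_point_measure_finite)
    finally show "emeasure (point_measure (I \<rightarrow>\<^sub>E X) (\<lambda>x. \<Prod>i\<in>I. p (x i))) (Pi\<^sub>E I A) =
      (\<Prod>i\<in>I. emeasure (point_measure X p) (A i))" .
  qed
qed

lemma integral_PiM_point_measure:
  fixes p :: "'x \<Rightarrow> real"
  assumes I: "finite I" and X: "finite X" and p: "\<And>x. x \<in> X \<Longrightarrow> 0 \<le> p x"
  shows "(\<integral>x. F x \<partial>(\<Pi>\<^sub>M i\<in>I. point_measure X p)) = pexp I X (\<lambda>_. p) F"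
proof -
  have eq: "(\<Pi>\<^sub>M i\<in>I. point_measure X p) = point_measure (I \<rightarrow>\<^sub>E X) (\<lambda>x. \<Prod>i\<in>I. p (x i))"
    by (rule PiM_point_measure) fact+
  show ?thesis
    unfolding eq pexp_def using I X p
    by (subst lebesgue_integral_point_measure_finite)
      (auto intro!: finite_PiE prod_nonneg simp: PiE_mem)
qed

section \<open>Products of biased signs\<close>

text \<open>The probability of the sign \<open>z\<close> under mean \<open>m\<close>. It is affine
  in \<open>m\<close>, which makes a change of mean an exact identity in
  \<open>bern_shift\<close>.\<close>

definition bern :: "real \<Rightarrow> real \<Rightarrow> real" where
  "bern m z = (1 + m * z) / 2"

abbreviation signs :: "real set" where "signs \<equiv> {-1, 1}"

lemma bern_sum: "(\<Sum>z\<in>signs. bern m z) = 1"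
  by (simp add: bern_def field_simps)

lemma bern_nonneg: "\<bar>m\<bar> \<le> 1 \<Longrightarrow> z \<in> signs \<Longrightarrow> 0 \<le> bern m z"
  by (auto simp: bern_def)

text \<open>Hoeffding's lemma for a Bernoulli variable \<open>B\<close> of parameter
  \<open>p\<close>: \<open>z = 2 * B - 1\<close> gives \<open>z - m = 2 * (B - p)\<close>, so the
  exponent \<open>2 * x\<close> yields \<open>(2 * x)\<^sup>2 / 8\<close>.\<close>

lemma bern_mgf:
  assumes m: "\<bar>m\<bar> < 1" and x: "0 \<le> x"
  shows "(\<Sum>z\<in>signs. bern m z * exp (x * (z - m))) \<le> exp (x\<^sup>2 / 2)"
proof -
  define p where "p = (1 + m) / 2"
  have p: "0 < p" "p < 1" using m by (auto simp: p_def)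
  define E where "E = 1 + p * (exp (2 * x) - 1)"
  have E: "1 \<le> E" using p x by (simp add: E_def)
  have "- (2 * x) * p + ln E \<le> (2 * x)\<^sup>2 / 8"
    unfolding E_def using Hoeffdings_lemma_aux[of "2 * x" p] x p by simp
  then have *: "exp (- (2 * x) * p + ln E) \<le> exp (x\<^sup>2 / 2)"
    by (simp add: power_mult_distrib)
  have "(\<Sum>z\<in>signs. bern m z * exp (x * (z - m))) = (1 - p) * exp (- (2 * x) * p) + p * exp (2 * x - 2 * x * p)"
  proof -
    have "bern m 1 = p" "bern m (- 1) = 1 - p" "x * (1 - m) = 2 * x - 2 * x * p"
      "x * (- 1 - m) = - (2 * x) * p"
      by (simp_all add: bern_def p_def field_simps)
    then show ?thesis by (simp del: mult_minus_left mult_minus_right)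
  qed
  also have "\<dots> = exp (- (2 * x) * p) * E"
    by (simp add: E_def exp_diff exp_minus field_simps)
  also have "\<dots> = exp (- (2 * x) * p + ln E)" using E by (simp only: exp_add exp_ln)
  finally show ?thesis using * by simp
qed

definition coin :: "'j set \<Rightarrow> ('j \<Rightarrow> real) \<Rightarrow> ('j \<Rightarrow> real) \<Rightarrow> real" where
  "coin J m z = (\<Prod>j\<in>J. bern (m j) (z j))"

lemma sum_coin: "(\<Sum>z\<in>J \<rightarrow>\<^sub>E signs. coin J m z * F z) = pexp J signs (\<lambda>j. bern (m j)) F"
  by (simp add: pexp_def coin_def)

lemma coin_total: "finite J \<Longrightarrow> (\<Sum>z\<in>J \<rightarrow>\<^sub>E signs. coin J m z) = 1"
  using pexp_const[of J signs "\<lambda>j. bern (m j)" 1] sum_coin[of J m "\<lambda>_. 1"] bern_sum by auto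

lemma coin_nonneg:
  assumes "\<And>j. j \<in> J \<Longrightarrow> \<bar>m j\<bar> \<le> 1" "z \<in> J \<rightarrow>\<^sub>E signs"
  shows "0 \<le> coin J m z"
  unfolding coin_def using assms by (intro prod_nonneg) (auto intro!: bern_nonneg simp: PiE_iff)

text \<open>The factor two allowed for \<open>(c j)\<^sup>2\<close> cancels the \<open>1 / 2\<close>
  of Hoeffding's lemma, leaving a bound free of the weights.\<close>

lemma coin_mgf:
  assumes J: "finite J" and m: "\<And>j. j \<in> J \<Longrightarrow> \<bar>m j\<bar> < 1"
    and c: "\<And>j. j \<in> J \<Longrightarrow> 0 \<le> c j" "\<And>j. j \<in> J \<Longrightarrow> (c j)\<^sup>2 \<le> 2"
    and x: "\<And>j. j \<in> J \<Longrightarrow> 0 \<le> x j"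
  shows "(\<Sum>z\<in>J \<rightarrow>\<^sub>E signs. coin J m z * exp (\<Sum>j\<in>J. x j * (c j * (z j - m j)))) \<le> exp (\<Sum>j\<in>J. (x j)\<^sup>2)"
proof -
  have "(\<Sum>z\<in>J \<rightarrow>\<^sub>E signs. coin J m z * exp (\<Sum>j\<in>J. x j * (c j * (z j - m j)))) =
      pexp J signs (\<lambda>j. bern (m j)) (\<lambda>z. \<Prod>j\<in>J. exp (x j * c j * (z j - m j)))"
    unfolding sum_coin using J by (simp add: exp_sum mult.assoc)
  also have "\<dots> = (\<Prod>j\<in>J. \<Sum>z\<in>signs. bern (m j) z * exp (x j * c j * (z - m j)))"
    using J by (subst pexp_prod[where f = "\<lambda>j z. exp (x j * c j * (z - m j))"]) auto
  also have "\<dots> \<le> (\<Prod>j\<in>J. exp ((x j)\<^sup>2))"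
  proof (rule prod_mono, intro conjI)
    fix j assume j: "j \<in> J"
    show "0 \<le> (\<Sum>z\<in>signs. bern (m j) z * exp (x j * c j * (z - m j)))"
      using m[OF j] bern_nonneg[of "m j"] by (intro sum_nonneg mult_nonneg_nonneg) auto
    have "(\<Sum>z\<in>signs. bern (m j) z * exp (x j * c j * (z - m j))) \<le> exp ((x j * c j)\<^sup>2 / 2)"
      using m[OF j] x[OF j] c(1)[OF j] by (intro bern_mgf) auto
    also have "(x j * c j)\<^sup>2 / 2 \<le> (x j)\<^sup>2"
      using mult_left_mono[OF c(2)[OF j], of "(x j)\<^sup>2"] by (simp add: power_mult_distrib)
    then have "exp ((x j * c j)\<^sup>2 / 2) \<le> exp ((x j)\<^sup>2)" by simp
    finally show "(\<Sum>z\<in>signs. bern (m j) z * exp (x j * c j * (z - m j))) \<le> exp ((x j)\<^sup>2)" .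
  qed
  also have "\<dots> = exp (\<Sum>j\<in>J. (x j)\<^sup>2)" using J by (simp add: exp_sum)
  finally show ?thesis .
qed

section \<open>Changing one mean in the likelihood\<close>

text \<open>\<open>(z - m) / (1 - m\<^sup>2)\<close> is the derivative of
  \<open>ln (bern m z)\<close> in \<open>m\<close>. As \<open>bern\<close> is affine in
  \<open>m\<close>, the first-order expansion of the likelihood ratio has no remainder.\<close>

lemma bern_shift:
  assumes "\<bar>m\<bar> < 1" "z \<in> signs"
  shows "bern m' z = bern m z * (1 + (m' - m) * ((z - m) / (1 - m\<^sup>2)))"
proof -
  have nz: "1 - m \<noteq> 0" "1 + m \<noteq> 0" using assms(1) by auto
  have sq: "1 - m\<^sup>2 = (1 - m) * (1 + m)" by (simp add: power2_eq_square algebra_simps)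
  from assms(2) consider "z = 1" | "z = -1" by auto
  then show ?thesis
  proof cases
    case 1
    have e: "(1 - m) / (1 - m\<^sup>2) = 1 / (1 + m)" unfolding sq using nz by simp
    then show ?thesis unfolding 1 bern_def e using nz by (simp add: field_simps)
  next
    case 2
    have "(- 1 - m) / (1 - m\<^sup>2) = - ((1 + m) / ((1 - m) * (1 + m)))"
      unfolding sq minus_divide_left by simp
    also have "\<dots> = - (1 / (1 - m))" using nz by simp
    finally have e: "(- 1 - m) / (1 - m\<^sup>2) = - (1 / (1 - m))" .
    then show ?thesis unfolding 2 bern_def e using nz by (simp add: field_simps)
  qed
qed

lemma coin_shift:
  assumes "finite J" "j \<in> J" "\<bar>m j\<bar> < 1" "z \<in> J \<rightarrow>\<^sub>E signs"
  shows "coin J (m(j := m')) z = coin J m z * (1 + (m' - m j) * ((z j - m j) / (1 - (m j)\<^sup>2)))"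
proof -
  have z: "z j \<in> signs" using assms by (auto simp: PiE_iff)
  have "(\<Prod>i\<in>J - {j}. bern ((m(j := m')) i) (z i)) = (\<Prod>i\<in>J - {j}. bern (m i) (z i))"
    by (intro prod.cong) auto
  then show ?thesis
    unfolding coin_def using assms(1,2) bern_shift[OF assms(3) z, of m']
    by (simp add: prod.remove[of J j])
qed

text \<open>Each new factor adds \<open>(P - 1) * x a\<close> to the error. While
  \<open>N * b\<close> is at most one, \<open>P - 1\<close> is at most \<open>2 * (N * b)\<close> in
  absolute value, and the new error fits the cross term of
  \<open>((N + 1) * b)\<^sup>2\<close>.\<close>

lemma prod_one_plus_approx:
  fixes x :: "'a \<Rightarrow> real"
  assumes "finite A" "\<And>a. a \<in> A \<Longrightarrow> \<bar>x a\<bar> \<le> b" "real (card A) * b \<le> 1" "0 \<le> b"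
  shows "\<bar>(\<Prod>a\<in>A. 1 + x a) - 1 - (\<Sum>a\<in>A. x a)\<bar> \<le> (real (card A) * b)\<^sup>2"
  using assms
proof (induction A rule: finite_induct)
  case (insert a A)
  define P S N where "P = (\<Prod>a\<in>A. 1 + x a)" and "S = (\<Sum>a\<in>A. x a)" and "N = real (card A)"
  have N: "0 \<le> N" by (simp add: N_def)
  have card: "real (card (insert a A)) = N + 1" using insert by (simp add: N_def)
  have Nb: "N * b + b \<le> 1" using insert.prems(2) unfolding card by (simp add: algebra_simps)
  have IH: "\<bar>P - 1 - S\<bar> \<le> (N * b)\<^sup>2"
    unfolding P_def S_def N_def using insert.prems Nb \<open>0 \<le> b\<close>
    by (intro insert.IH) (auto simp: N_def)
  have S: "\<bar>S\<bar> \<le> N * b"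
    unfolding S_def N_def using insert.prems
    by (intro order.trans[OF sum_abs] order.trans[OF sum_bounded_above[of A _ b]]) auto
  have "(N * b)\<^sup>2 \<le> N * b * 1"
    unfolding power2_eq_square using N Nb \<open>0 \<le> b\<close> by (intro mult_left_mono) auto
  then have P: "\<bar>P - 1\<bar> \<le> 2 * (N * b)" using IH S by linarith
  have xa: "\<bar>x a\<bar> \<le> b" using insert.prems by auto
  have "\<bar>(P - 1) * x a\<bar> \<le> 2 * (N * b) * b"
    unfolding abs_mult using P xa N \<open>0 \<le> b\<close> by (intro mult_mono) auto
  then have "\<bar>(P - 1 - S) + (P - 1) * x a\<bar> \<le> (N * b)\<^sup>2 + 2 * (N * b) * b" using IH by linarith
  also have "\<dots> \<le> ((N + 1) * b)\<^sup>2" by (simp add: power2_eq_square algebra_simps)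
  also have "(P - 1 - S) + (P - 1) * x a = (1 + x a) * P - 1 - (x a + S)" by (simp add: algebra_simps)
  finally show ?case unfolding card using insert by (simp add: P_def S_def)
qed simp

text \<open>The derivative of the likelihood in \<open>m j\<close> is the likelihood times the sum of the scores
  \<open>(z j - m j) / (1 - (m j)\<^sup>2)\<close>; this is its finite-difference form.\<close>

lemma coin_sample_shift:
  fixes W :: "(nat \<Rightarrow> 'j \<Rightarrow> real) \<Rightarrow> real"
  assumes J: "finite J" "j \<in> J" and m: "\<And>i. i \<in> J \<Longrightarrow> \<bar>m i\<bar> \<le> 1" "0 \<le> m j" "m j \<le> 1/2"
    and W: "\<And>S. S \<in> {1..n} \<rightarrow>\<^sub>E (J \<rightarrow>\<^sub>E signs) \<Longrightarrow> \<bar>W S\<bar> \<le> 1"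
    and e: "0 \<le> e" "2 * real n * e \<le> 1"
  shows "pexp {1..n} (J \<rightarrow>\<^sub>E signs) (\<lambda>_. coin J (m(j := m j + e))) W -
      pexp {1..n} (J \<rightarrow>\<^sub>E signs) (\<lambda>_. coin J m) W
    \<le> e * pexp {1..n} (J \<rightarrow>\<^sub>E signs) (\<lambda>_. coin J m)
          (\<lambda>S. W S * (\<Sum>i\<in>{1..n}. (S i j - m j) / (1 - (m j)\<^sup>2))) + (2 * real n * e)\<^sup>2"
proof -
  let ?I = "{1..n}" and ?V = "J \<rightarrow>\<^sub>E signs"
  define s where "s = (\<lambda>z::'j \<Rightarrow> real. (z j - m j) / (1 - (m j)\<^sup>2))"
  have fV: "finite ?V" using J by (intro finite_PiE) auto
  have mj: "\<bar>m j\<bar> < 1" using m by auto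
  \<comment> \<open>The bound 2 comes from \<open>m j \<le> 1/2\<close>: after cancelling
    \<open>1 + m j\<close> it amounts to \<open>1 \<le> 2 * (1 - m j)\<close>.\<close>
  have sb: "\<bar>s z\<bar> \<le> 2" if "z \<in> ?V" for z
  proof -
    have zj: "z j \<in> signs" using that J by (auto simp: PiE_iff)
    have "m j * m j \<le> 1/2 * m j" using m(2,3) by (intro mult_right_mono)
    then have q: "1 + m j \<le> 2 * (1 - (m j)\<^sup>2)" and q0: "0 < 1 - (m j)\<^sup>2"
      using m(2,3) by (auto simp: power2_eq_square)
    have "\<bar>z j - m j\<bar> \<le> 1 + m j" using zj m(2,3) by auto
    then have "\<bar>z j - m j\<bar> \<le> 2 * (1 - (m j)\<^sup>2)" using q by linarith
    then show ?thesis using q0 by (simp only: s_def abs_divide abs_of_pos pos_divide_le_eq)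
  qed
  have shift: "(\<Prod>i\<in>?I. coin J (m(j := m j + e)) (S i)) =
      (\<Prod>i\<in>?I. coin J m (S i)) * (\<Prod>i\<in>?I. 1 + e * s (S i))" if "S \<in> ?I \<rightarrow>\<^sub>E ?V" for S
  proof -
    have "coin J (m(j := m j + e)) (S i) = coin J m (S i) * (1 + e * s (S i))" if "i \<in> ?I" for i
      using coin_shift[OF J, of m "S i" "m j + e"] mj PiE_mem[OF \<open>S \<in> _\<close> that] by (simp add: s_def)
    then show ?thesis by (simp only: prod.distrib[symmetric] cong: prod.cong)
  qed
  have eq: "pexp ?I ?V (\<lambda>_. coin J (m(j := m j + e))) W =
      pexp ?I ?V (\<lambda>_. coin J m) (\<lambda>S. (\<Prod>i\<in>?I. 1 + e * s (S i)) * W S)"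
    unfolding pexp_def by (intro sum.cong refl) (simp only: shift mult.assoc)
  have "pexp ?I ?V (\<lambda>_. coin J (m(j := m j + e))) W - pexp ?I ?V (\<lambda>_. coin J m) W =
      pexp ?I ?V (\<lambda>_. coin J m) (\<lambda>S. ((\<Prod>i\<in>?I. 1 + e * s (S i)) - 1) * W S)"
    unfolding eq pexp_diff[symmetric] by (simp only: left_diff_distrib mult_1)
  also have "\<dots> \<le> pexp ?I ?V (\<lambda>_. coin J m)
      (\<lambda>S. e * (W S * (\<Sum>i\<in>?I. s (S i))) + (2 * real n * e)\<^sup>2)"
  proof (rule pexp_mono)
    fix S assume S: "S \<in> ?I \<rightarrow>\<^sub>E ?V"
    have "\<bar>e * s (S i)\<bar> \<le> 2 * e" if "i \<in> ?I" for i
      using mult_right_mono[OF sb[OF PiE_mem[OF S that]] e(1)] e(1) by (simp add: abs_mult mult.commute)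
    then have "\<bar>(\<Prod>i\<in>?I. 1 + e * s (S i)) - 1 - (\<Sum>i\<in>?I. e * s (S i))\<bar> \<le> (real (card ?I) * (2 * e))\<^sup>2"
      using e by (intro prod_one_plus_approx) (auto simp: mult_ac)
    then have "\<bar>(\<Prod>i\<in>?I. 1 + e * s (S i)) - 1 - (\<Sum>i\<in>?I. e * s (S i))\<bar> * \<bar>W S\<bar> \<le> (2 * real n * e)\<^sup>2 * 1"
      using W[OF S] by (intro mult_mono) (auto simp: mult_ac)
    then have le: "((\<Prod>i\<in>?I. 1 + e * s (S i)) - 1 - (\<Sum>i\<in>?I. e * s (S i))) * W S \<le> (2 * real n * e)\<^sup>2"
      by (simp only: abs_mult[symmetric] mult_1_right)
    have *: "(P - 1) * w \<le> e * (w * Q) + r" if "(P - 1 - e * Q) * w \<le> r" for P Q w r :: real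
      using that by (simp add: algebra_simps)
    show "((\<Prod>i\<in>?I. 1 + e * s (S i)) - 1) * W S \<le>
        e * (W S * (\<Sum>i\<in>?I. s (S i))) + (2 * real n * e)\<^sup>2"
      by (rule *) (use le in \<open>simp only: sum_distrib_left\<close>)
  qed (use m in \<open>auto intro!: coin_nonneg\<close>)
  also have "\<dots> = e * pexp ?I ?V (\<lambda>_. coin J m) (\<lambda>S. W S * (\<Sum>i\<in>?I. s (S i))) + (2 * real n * e)\<^sup>2"
    using fV J by (simp add: pexp_add pexp_cmult pexp_const coin_total)
  finally show ?thesis by (simp only: s_def)
qed

section \<open>The geometric prior\<close>

text \<open>Level \<open>l\<close> will stand for a mean \<open>l\<close> grid steps above 0. Given
  \<open>l > 0\<close>, this is a geometric variable cut off at \<open>L\<close>, reaching level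
  \<open>i\<close> with probability \<open>q ^ (i - 1)\<close>; the top level collects the remaining
  tail. The grid keeps the prior a finite sum, at the price of differences in place of
  derivatives.\<close>

definition level_prior :: "nat \<Rightarrow> real \<Rightarrow> nat \<Rightarrow> real" where
  "level_prior L q l = (if l = 0 then 1 / 2 else if l < L then (1 - q) / q / 2 * q ^ l else q ^ (L - 1) / 2)"

text \<open>The weight at \<open>0\<close> makes weight times prior exactly geometric below \<open>L\<close>, so that the boundary
  terms of the summation by parts are again multiples of the prior.\<close>

definition level_weight :: "nat \<Rightarrow> real \<Rightarrow> nat \<Rightarrow> real" where
  "level_weight L q l = (if l < L then if l = 0 then (1 - q) / q else 1 else 0)"

text \<open>The sign with which a level enters after summation by parts: only the lower boundary
  term is negative.\<close>

definition level_sign :: "nat \<Rightarrow> real" where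
  "level_sign l = (if l = 0 then -1 else 1)"

text \<open>Weight times prior is \<open>(1 - q) / q / 2 * q ^ l\<close> below \<open>L\<close>.
  Abel summation moves the difference onto \<open>q ^ l\<close>, and
  \<open>q ^ (l - 1) - q ^ l = (1 - q) / q * q ^ l\<close> restores the geometric law; the upper
  boundary term \<open>q ^ (L - 1)\<close> is twice the atom at \<open>L\<close>.\<close>

lemma level_summation_by_parts:
  fixes g :: "nat \<Rightarrow> real"
  assumes q: "0 < q" and L: "1 \<le> L"
  shows "(\<Sum>l\<in>{0..L}. level_prior L q l * (level_weight L q l * (g (Suc l) - g l))) =
     (1 - q) / q * (\<Sum>l\<in>{0..L}. level_prior L q l * (level_sign l * g l))"
proof -
  have parts: "(\<Sum>l<L. q ^ l * (g (Suc l) - g l)) =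
      q ^ (L - 1) * g L + (\<Sum>l\<in>{1..<L}. (1 - q) / q * q ^ l * g l) - g 0"
    using L
  proof (induction L rule: dec_induct)
    case (step n)
    then obtain k where n: "n = Suc k" by (cases n) auto
    have "q ^ (n - 1) * g n - q ^ n * g n = (1 - q) / q * q ^ n * g n"
      using q by (simp add: n field_simps)
    then show ?case
      using step.IH step.hyps(1) by (simp add: sum.atLeastLessThan_Suc right_diff_distrib)
  qed simp
  define T where "T = (\<Sum>l\<in>{1..<L}. (1 - q) / q * q ^ l * g l)"
  have "(\<Sum>l\<in>{0..L}. level_prior L q l * (level_weight L q l * (g (Suc l) - g l))) =
     (\<Sum>l<L. level_prior L q l * (level_weight L q l * (g (Suc l) - g l)))"
    by (rule sum.mono_neutral_right) (auto simp: level_weight_def)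
  also have "\<dots> = (\<Sum>l<L. (1 - q) / q / 2 * (q ^ l * (g (Suc l) - g l)))"
    by (intro sum.cong) (auto simp: level_prior_def level_weight_def)
  also have "\<dots> = (1 - q) / q / 2 * (q ^ (L - 1) * g L + T - g 0)"
    unfolding T_def parts[symmetric] by (simp add: sum_distrib_left)
  also have "\<dots> = (1 - q) / q * (level_prior L q L * (level_sign L * g L) +
      (\<Sum>l\<in>{1..<L}. level_prior L q l * (level_sign l * g l)) + level_prior L q 0 * (level_sign 0 * g 0))"
  proof -
    have "(\<Sum>l\<in>{1..<L}. level_prior L q l * (level_sign l * g l)) =
       (\<Sum>l\<in>{1..<L}. 1 / 2 * ((1 - q) / q * q ^ l * g l))"
      by (intro sum.cong) (auto simp: level_prior_def level_sign_def)
    also have "\<dots> = 1 / 2 * T"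
      unfolding T_def by (simp only: sum_distrib_left)
    finally have "(\<Sum>l\<in>{1..<L}. level_prior L q l * (level_sign l * g l)) = 1 / 2 * T" .
    moreover have "level_prior L q L * (level_sign L * g L) = q ^ (L - 1) * g L / 2"
      "level_prior L q 0 * (level_sign 0 * g 0) = - g 0 / 2"
      using L by (auto simp: level_prior_def level_sign_def)
    moreover have "x / 2 * (a + T - g 0) = x * (a / 2 + 1 / 2 * T + - g 0 / 2)" for x a
      by (simp add: algebra_simps)
    ultimately show ?thesis by (simp only:)
  qed
  also have "level_prior L q L * (level_sign L * g L) +
      (\<Sum>l\<in>{1..<L}. level_prior L q l * (level_sign l * g l)) + level_prior L q 0 * (level_sign 0 * g 0) =
      (\<Sum>l\<in>{0..L}. level_prior L q l * (level_sign l * g l))"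
  proof -
    have "{0..L} = insert 0 (insert L {1..<L})" using L by auto
    then show ?thesis using L by simp
  qed
  finally show ?thesis .
qed

lemma level_prior_nonneg: "0 < q \<Longrightarrow> q < 1 \<Longrightarrow> 0 \<le> level_prior L q l"
  by (simp add: level_prior_def)

text \<open>Summation by parts for a constant function shows that the signed masses cancel, so the
  levels above 0 together carry as much as level 0, namely one half.\<close>

lemma level_prior_sum:
  assumes q: "0 < q" "q < 1" and L: "1 \<le> L"
  shows "(\<Sum>l\<in>{0..L}. level_prior L q l) = 1"
proof -
  have "(\<Sum>l\<in>{0..L}. level_prior L q l * level_sign l) = 0"
    using level_summation_by_parts[OF q(1) L, of "\<lambda>_. 1"] q by simp
  moreover have "(\<Sum>l\<in>{0..L}. level_prior L q l) =
      (\<Sum>l\<in>{0..L}. level_prior L q l * level_sign l) + (\<Sum>l\<in>{0..L}. if l = 0 then 1 else 0)"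
    unfolding sum.distrib[symmetric]
    by (intro sum.cong) (auto simp: level_sign_def level_prior_def)
  ultimately show ?thesis by simp
qed

lemma pexp_summation_by_parts:
  assumes "finite J" "j \<in> J" "0 < q" "1 \<le> L"
  shows "pexp J {0..L} (\<lambda>_. level_prior L q) (\<lambda>l. level_weight L q (l j) * (F (l(j := Suc (l j))) - F l)) =
    (1 - q) / q * pexp J {0..L} (\<lambda>_. level_prior L q) (\<lambda>l. level_sign (l j) * F l)"
proof -
  define g where "g y = pexp (J - {j}) {0..L} (\<lambda>_. level_prior L q) (\<lambda>l. F (l(j := y)))" for y
  have "pexp J {0..L} (\<lambda>_. level_prior L q) (\<lambda>l. level_weight L q (l j) * (F (l(j := Suc (l j))) - F l)) =
    (\<Sum>y\<in>{0..L}. level_prior L q y * (level_weight L q y * (g (Suc y) - g y)))"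
    using assms by (subst pexp_split[of J _ j]) (auto simp: g_def pexp_cmult pexp_diff)
  also have "\<dots> = (1 - q) / q * (\<Sum>y\<in>{0..L}. level_prior L q y * (level_sign y * g y))"
    using assms by (intro level_summation_by_parts)
  also have "(\<Sum>y\<in>{0..L}. level_prior L q y * (level_sign y * g y)) =
      pexp J {0..L} (\<lambda>_. level_prior L q) (\<lambda>l. level_sign (l j) * F l)"
    using assms by (subst pexp_split[of J _ j]) (auto simp: g_def pexp_cmult)
  finally show ?thesis .
qed

section \<open>Scores of block parameters\<close>

abbreviation block :: "nat \<Rightarrow> nat \<Rightarrow> nat set" where
  "block k t \<equiv> {t * k..<t * k + k}"

text \<open>A condition on plain functions, blind to values outside the first \<open>s * k\<close>
  coordinates, so that it applies equally to outputs, averaged outputs and comparison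
  vectors.\<close>

definition feasible :: "nat \<Rightarrow> nat \<Rightarrow> (nat \<Rightarrow> real) \<Rightarrow> bool" where
  "feasible s k x \<longleftrightarrow> (\<forall>j<s * k. 0 \<le> x j) \<and> (\<forall>t<s. (\<Sum>j\<in>block k t. x j) = 1 / real s)"

lemma block_subset:
  assumes "t < s" shows "block k t \<subseteq> {..<s * k}"
proof -
  have "t * k + k \<le> s * k" using assms mult_le_mono1[of "Suc t" s k] by simp
  then show ?thesis by auto
qed

lemma mem_block: "0 < k \<Longrightarrow> j < s * k \<Longrightarrow> j div k < s \<and> j \<in> block k (j div k)"
  by (auto simp: less_mult_imp_div_less div_mult_mod_eq dividend_less_div_times)
     (metis add.commute dividend_less_times_div mult.commute)

lemma feasible_le:
  assumes "feasible s k x" "0 < k" "j < s * k"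
  shows "x j \<le> 1 / real s"
proof -
  have t: "j div k < s" "j \<in> block k (j div k)" using mem_block assms by blast+
  have "x j \<le> (\<Sum>j\<in>block k (j div k). x j)"
    using assms(1) t block_subset[of "j div k" s k] by (intro member_le_sum) (auto simp: feasible_def)
  then show ?thesis using assms(1) t by (simp add: feasible_def)
qed

lemma feasible_sum:
  assumes "feasible s k x" "0 < s"
  shows "(\<Sum>j<s * k. x j) = 1"
proof -
  have "(\<Sum>j<s * k. x j) = (\<Sum>t<s. \<Sum>j\<in>block k t. x j)"
    by (rule sum.nat_group[symmetric])
  also have "\<dots> = (\<Sum>t<s. 1 / real s)"
    using assms(1) by (intro sum.cong) (auto simp: feasible_def)
  finally show ?thesis using assms(2) by simp
qed

text \<open>Largest entry times total mass. This is the gain from splitting into blocks: the sum of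
  squares controls the fluctuation of a fresh score.\<close>

lemma feasible_sum_squares:
  assumes "feasible s k x" "0 < s" "0 < k"
  shows "(\<Sum>j<s * k. (x j)\<^sup>2) \<le> 1 / real s"
proof -
  have "(\<Sum>j<s * k. (x j)\<^sup>2) \<le> (\<Sum>j<s * k. x j * (1 / real s))"
    unfolding power2_eq_square using feasible_le[OF assms(1,3)] assms(1)
    by (intro sum_mono mult_left_mono) (auto simp: feasible_def)
  also have "\<dots> = 1 / real s"
    unfolding sum_distrib_right[symmetric] feasible_sum[OF assms(1,2)] by simp
  finally show ?thesis .
qed

definition score :: "nat \<Rightarrow> nat \<Rightarrow> (nat \<Rightarrow> real) \<Rightarrow> (nat \<Rightarrow> real) \<Rightarrow> (nat \<Rightarrow> real) \<Rightarrow> (nat \<Rightarrow> real) \<Rightarrow> real" where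
  "score s k c m x z = (\<Sum>j<s * k. x j * (c j * (z j - m j)))"

text \<open>In the application \<open>c j\<close> is \<open>r j / (1 - (m j)\<^sup>2)\<close> with
  \<open>r j\<close> from fingerprinting; \<open>r j \<le> 1\<close> and
  \<open>m j \<le> 1/2\<close> make it at most \<open>4/3\<close>, whence the bound on its
  square.\<close>

locale scoring =
  fixes s k :: nat and c m :: "nat \<Rightarrow> real"
  assumes s: "0 < s" and k: "0 < k"
    and m: "\<And>j. j < s * k \<Longrightarrow> \<bar>m j\<bar> < 1"
    and c: "\<And>j. j < s * k \<Longrightarrow> 0 \<le> c j" "\<And>j. j < s * k \<Longrightarrow> (c j)\<^sup>2 \<le> 2"
begin

abbreviation "cube \<equiv> {..<s * k} \<rightarrow>\<^sub>E signs"
abbreviation "P \<equiv> coin {..<s * k} m"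
abbreviation "samples n \<equiv> {1..n} \<rightarrow>\<^sub>E cube"

lemma finite_cube: "finite cube"
  by (intro finite_PiE) auto

lemma P_nonneg: "z \<in> cube \<Longrightarrow> 0 \<le> P z"
  using m by (intro coin_nonneg) (auto simp: less_imp_le)

lemma P_total: "(\<Sum>z\<in>cube. P z) = 1"
  by (simp add: coin_total)

lemma score_mgf:
  assumes "\<And>j. j < s * k \<Longrightarrow> 0 \<le> x j"
  shows "(\<Sum>z\<in>cube. P z * exp (score s k c m x z)) \<le> exp (\<Sum>j<s * k. (x j)\<^sup>2)"
  unfolding score_def using m c assms by (intro coin_mgf) auto

lemma score_tail:
  assumes x: "feasible s k x" and l: "0 \<le> l"
  shows "(\<Sum>z\<in>cube. P z * of_bool (l \<le> score s k c m x z)) \<le> exp (- (real s * l\<^sup>2 / 4))"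
proof -
  \<comment> \<open>The Chernoff parameter, minimising \<open>e\<^sup>2 / s - e * l\<close>.\<close>
  define e where "e = real s * l / 2"
  have e: "0 \<le> e" using l by (simp add: e_def)
  have sc: "score s k c m (\<lambda>j. e * x j) z = e * score s k c m x z" for z
    unfolding score_def by (simp add: sum_distrib_left mult.assoc)
  have "(\<Sum>z\<in>cube. P z * of_bool (l \<le> score s k c m x z)) \<le>
      (\<Sum>z\<in>cube. P z * (exp (- (e * l)) * exp (score s k c m (\<lambda>j. e * x j) z)))"
  proof (intro sum_mono mult_left_mono P_nonneg)
    fix z
    show "of_bool (l \<le> score s k c m x z) \<le> exp (- (e * l)) * exp (score s k c m (\<lambda>j. e * x j) z)"
    proof (cases "l \<le> score s k c m x z")
      case True
      then have "e * l \<le> e * score s k c m x z" using e by (intro mult_left_mono)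
      then show ?thesis using True unfolding sc exp_add[symmetric] by simp
    qed simp
  qed
  also have "\<dots> = exp (- (e * l)) * (\<Sum>z\<in>cube. P z * exp (score s k c m (\<lambda>j. e * x j) z))"
    by (simp add: sum_distrib_left mult.left_commute)
  also have "\<dots> \<le> exp (- (e * l)) * exp (\<Sum>j<s * k. (e * x j)\<^sup>2)"
    using e x by (intro mult_left_mono score_mgf) (auto simp: feasible_def)
  also have "\<dots> = exp (e\<^sup>2 * (\<Sum>j<s * k. (x j)\<^sup>2) - e * l)"
    by (simp add: exp_add[symmetric] power_mult_distrib sum_distrib_left)
  also have "\<dots> \<le> exp (e\<^sup>2 * (1 / real s) - e * l)"
    using mult_left_mono[OF feasible_sum_squares[OF x s k], of "e\<^sup>2"] by simp
  also have "e\<^sup>2 * (1 / real s) - e * l = - (real s * l\<^sup>2 / 4)"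
    using s by (simp add: e_def field_simps power2_eq_square)
  finally show ?thesis .
qed

section \<open>Uniform control of large scores through the vertices\<close>

text \<open>One coordinate per block: these index the vertices of the feasible polytope, and
  \<open>choice_score\<close> is \<open>s\<close> times the score of the vertex.\<close>

definition choices :: "(nat \<Rightarrow> nat) set" where
  "choices = Pi\<^sub>E {..<s} (block k)"

definition choice_score :: "(nat \<Rightarrow> nat) \<Rightarrow> (nat \<Rightarrow> real) \<Rightarrow> real" where
  "choice_score b z = (\<Sum>t<s. c (b t) * (z (b t) - m (b t)))"

lemma card_choices: "card choices = k ^ s"
  unfolding choices_def by (simp add: card_PiE)

lemma choice_score_mgf:
  assumes b: "b \<in> choices" and a: "0 \<le> a"
  shows "(\<Sum>z\<in>cube. P z * exp (a * choice_score b z)) \<le> exp (real s * a\<^sup>2)"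
proof -
  have bt: "b t \<in> block k t" if "t < s" for t using b that by (auto simp: choices_def PiE_iff)
  have div: "b t div k = t" if "t < s" for t
    using bt[OF that] k by (intro div_nat_eqI) (auto simp: mult.commute)
  have inj: "inj_on b {..<s}" by (rule inj_on_inverseI[of _ "\<lambda>j. j div k"]) (use div in auto)
  have sub: "b ` {..<s} \<subseteq> {..<s * k}" using bt block_subset by blast
  define x where "x j = (if j \<in> b ` {..<s} then a else 0)" for j
  have "score s k c m x z = a * choice_score b z" for z
  proof -
    have "score s k c m x z = (\<Sum>j\<in>b ` {..<s}. x j * (c j * (z j - m j)))"
      unfolding score_def using sub by (intro sum.mono_neutral_right) (auto simp: x_def)
    also have "\<dots> = (\<Sum>t<s. x (b t) * (c (b t) * (z (b t) - m (b t))))"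
      by (simp add: sum.reindex[OF inj])
    also have "\<dots> = a * choice_score b z"
      unfolding choice_score_def sum_distrib_left by (intro sum.cong) (auto simp: x_def)
    finally show ?thesis .
  qed
  then have "(\<Sum>z\<in>cube. P z * exp (a * choice_score b z)) \<le> exp (\<Sum>j<s * k. (x j)\<^sup>2)"
    using score_mgf[of x] a by (simp add: x_def)
  also have "(\<Sum>j<s * k. (x j)\<^sup>2) = (\<Sum>j\<in>b ` {..<s}. (x j)\<^sup>2)"
    using sub by (intro sum.mono_neutral_right) (auto simp: x_def)
  also have "\<dots> = real s * a\<^sup>2"
    using card_image[OF inj] by (simp add: x_def)
  finally show ?thesis .
qed

text \<open>The numbers \<open>s * x j\<close> are probability weights on the block, so the exponent
  is at most \<open>a\<close> times the largest \<open>v j\<close>; the exponential of a maximum is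
  at most the sum of the exponentials.\<close>

lemma exp_block_le:
  assumes x: "feasible s k x" and t: "t < s" and a: "0 \<le> a"
  shows "exp (real s * a * (\<Sum>j\<in>block k t. x j * v j)) \<le> (\<Sum>j\<in>block k t. exp (a * v j))"
proof -
  define M where "M = Max (v ` block k t)"
  have ne: "v ` block k t \<noteq> {}" using k by auto
  have "M \<in> v ` block k t" unfolding M_def by (rule Max_in) (use ne in auto)
  then obtain i where i: "i \<in> block k t" "M = v i" by auto
  have le: "v j \<le> M" if "j \<in> block k t" for j
    unfolding M_def using that by (intro Max_ge) auto
  have "(\<Sum>j\<in>block k t. x j * v j) \<le> (\<Sum>j\<in>block k t. x j * M)"
    using x le block_subset[OF t, of k] by (intro sum_mono mult_left_mono) (auto simp: feasible_def)
  also have "\<dots> = M / real s" using x t by (simp add: feasible_def flip: sum_distrib_right)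
  finally have "real s * a * (\<Sum>j\<in>block k t. x j * v j) \<le> real s * a * (M / real s)"
    using a by (intro mult_left_mono) auto
  then have "exp (real s * a * (\<Sum>j\<in>block k t. x j * v j)) \<le> exp (a * v i)" using s i by simp
  also have "\<dots> \<le> (\<Sum>j\<in>block k t. exp (a * v j))"
    using i by (intro member_le_sum) auto
  finally show ?thesis .
qed

text \<open>The summand 1 stands for leaving a sample point out, so expanding the product runs over
  all subsets of the sample. The factor \<open>exp (- (real s * a\<^sup>2))\<close> normalises the
  moment generating function of a vertex to at most one.\<close>

definition choice_sum :: "nat \<Rightarrow> real \<Rightarrow> (nat \<Rightarrow> nat \<Rightarrow> real) \<Rightarrow> real" where
  "choice_sum n a S =
     (\<Sum>b\<in>choices. \<Prod>i\<in>{1..n}. exp (- (real s * a\<^sup>2)) * exp (a * choice_score b (S i)) + 1)"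

text \<open>\<open>exp (max 0 y) \<le> exp y + 1\<close> opens the product into a sum over subsets
  \<open>T\<close> of the sample. For fixed \<open>T\<close> the exponent is affine in the parameter
  and is dominated, block by block, by the vertices; summing over \<open>T\<close> closes the
  product again.\<close>

lemma exp_excess_le:
  assumes x: "feasible s k x" and a: "0 \<le> a"
  shows "exp (real s * a * (\<Sum>i\<in>{1..n}. max 0 (score s k c m x (S i) - a))) \<le> choice_sum n a S"
proof -
  define e where "e = real s * a"
  have e: "0 \<le> e" using a by (simp add: e_def)
  have split: "e * score s k c m x z = (\<Sum>t<s. e * (\<Sum>j\<in>block k t. x j * (c j * (z j - m j))))" for z
    unfolding score_def sum.nat_group[of _ k s, symmetric] by (simp add: sum_distrib_left)
  have subset: "(\<Prod>i\<in>T. exp (e * (score s k c m x (S i) - a))) \<le>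
      (\<Sum>b\<in>choices. \<Prod>i\<in>T. exp (- (real s * a\<^sup>2)) * exp (a * choice_score b (S i)))"
    if T: "finite T" for T
  proof -
    define v where "v j = (\<Sum>i\<in>T. c j * (S i j - m j))" for j
    have "(\<Sum>i\<in>T. e * score s k c m x (S i)) = (\<Sum>t<s. e * (\<Sum>j\<in>block k t. x j * v j))"
      unfolding split v_def sum_distrib_left by (rule trans[OF sum.swap]) (intro sum.cong refl sum.swap)
    then have "exp (\<Sum>i\<in>T. e * score s k c m x (S i)) = (\<Prod>t<s. exp (e * (\<Sum>j\<in>block k t. x j * v j)))"
      by (simp add: exp_sum)
    also have "\<dots> \<le> (\<Prod>t<s. \<Sum>j\<in>block k t. exp (a * v j))"
      unfolding e_def using exp_block_le[OF x _ a] by (intro prod_mono) auto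
    also have "\<dots> = (\<Sum>b\<in>choices. \<Prod>t<s. exp (a * v (b t)))"
      unfolding choices_def by (intro prod_sum_PiE) auto
    also have "\<dots> = (\<Sum>b\<in>choices. \<Prod>i\<in>T. exp (a * choice_score b (S i)))"
    proof (intro sum.cong refl)
      fix b
      have "(\<Sum>t<s. a * v (b t)) = (\<Sum>i\<in>T. a * choice_score b (S i))"
        unfolding v_def choice_score_def sum_distrib_left by (rule sum.swap)
      then show "(\<Prod>t<s. exp (a * v (b t))) = (\<Prod>i\<in>T. exp (a * choice_score b (S i)))"
        using T by (simp add: exp_sum[symmetric])
    qed
    finally have *: "exp (\<Sum>i\<in>T. e * score s k c m x (S i)) \<le>
        (\<Sum>b\<in>choices. \<Prod>i\<in>T. exp (a * choice_score b (S i)))" .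
    have "(\<Prod>i\<in>T. exp (e * (score s k c m x (S i) - a))) =
        (\<Prod>i\<in>T. exp (- (real s * a\<^sup>2)) * exp (e * score s k c m x (S i)))"
      by (intro prod.cong refl)
        (simp add: exp_add[symmetric] right_diff_distrib e_def power2_eq_square)
    also have "\<dots> = (\<Prod>i\<in>T. exp (- (real s * a\<^sup>2))) * exp (\<Sum>i\<in>T. e * score s k c m x (S i))"
      using T by (simp add: prod.distrib exp_sum)
    also have "\<dots> \<le> (\<Prod>i\<in>T. exp (- (real s * a\<^sup>2))) *
        (\<Sum>b\<in>choices. \<Prod>i\<in>T. exp (a * choice_score b (S i)))"
      using * by (intro mult_left_mono prod_nonneg) auto
    also have "\<dots> = (\<Sum>b\<in>choices. \<Prod>i\<in>T. exp (- (real s * a\<^sup>2)) * exp (a * choice_score b (S i)))"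
      by (simp add: sum_distrib_left prod.distrib)
    finally show ?thesis .
  qed
  have "exp (real s * a * (\<Sum>i\<in>{1..n}. max 0 (score s k c m x (S i) - a))) =
      (\<Prod>i\<in>{1..n}. exp (e * max 0 (score s k c m x (S i) - a)))"
    by (simp add: sum_distrib_left exp_sum e_def)
  also have "\<dots> \<le> (\<Prod>i\<in>{1..n}. exp (e * (score s k c m x (S i) - a)) + 1)"
    by (intro prod_mono) (auto simp: max_def add_increasing)
  also have "\<dots> = (\<Sum>T\<in>Pow {1..n}. \<Prod>i\<in>T. exp (e * (score s k c m x (S i) - a)))"
    by (simp add: prod_add)
  also have "\<dots> \<le> (\<Sum>T\<in>Pow {1..n}. \<Sum>b\<in>choices.
      \<Prod>i\<in>T. exp (- (real s * a\<^sup>2)) * exp (a * choice_score b (S i)))"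
    by (intro sum_mono subset) (auto intro: finite_subset)
  also have "\<dots> = (\<Sum>b\<in>choices. \<Sum>T\<in>Pow {1..n}.
      \<Prod>i\<in>T. exp (- (real s * a\<^sup>2)) * exp (a * choice_score b (S i)))"
    by (rule sum.swap)
  also have "\<dots> = choice_sum n a S"
    by (simp add: choice_sum_def prod_add)
  finally show ?thesis .
qed

text \<open>For a fixed vertex the sample points are independent, and each factor has expectation at
  most 1 + 1 after normalisation. There are \<open>k ^ s\<close> vertices.\<close>

lemma choice_sum_expectation:
  assumes a: "0 \<le> a"
  shows "pexp {1..n} cube (\<lambda>_. P) (choice_sum n a) \<le> 2 ^ n * real k ^ s"
proof -
  let ?f = "\<lambda>b z. exp (- (real s * a\<^sup>2)) * exp (a * choice_score b z) + 1"
  have "pexp {1..n} cube (\<lambda>_. P) (choice_sum n a) =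
      (\<Sum>b\<in>choices. \<Prod>i\<in>{1..n}. \<Sum>z\<in>cube. P z * ?f b z)"
    unfolding choice_sum_def pexp_sum using finite_cube by (intro sum.cong refl pexp_prod) auto
  also have "\<dots> \<le> (\<Sum>b\<in>choices. \<Prod>i\<in>{1..n}. 2)"
  proof (intro sum_mono prod_mono conjI)
    fix b assume b: "b \<in> choices"
    show "0 \<le> (\<Sum>z\<in>cube. P z * ?f b z)"
      using P_nonneg by (intro sum_nonneg mult_nonneg_nonneg) (auto simp: add_nonneg_nonneg)
    have "(\<Sum>z\<in>cube. P z * ?f b z) =
        exp (- (real s * a\<^sup>2)) * (\<Sum>z\<in>cube. P z * exp (a * choice_score b z)) + (\<Sum>z\<in>cube. P z)"
      by (simp add: distrib_left sum.distrib sum_distrib_left mult.left_commute)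
    also have "\<dots> \<le> exp (- (real s * a\<^sup>2)) * exp (real s * a\<^sup>2) + 1"
      unfolding P_total using choice_score_mgf[OF b a] by simp
    also have "\<dots> = 2" by (simp add: exp_minus)
    finally show "(\<Sum>z\<in>cube. P z * ?f b z) \<le> 2" .
  qed
  also have "\<dots> = 2 ^ n * real k ^ s" by (simp add: card_choices)
  finally show ?thesis .
qed

text \<open>The bound is uniform in \<open>x\<close>, which is what allows \<open>x\<close> to depend on the sample.
  Linearising the logarithm at the bound on the expectation replaces Jensen's inequality.\<close>

lemma excess_bound:
  assumes a: "0 < a"
  obtains G where
    "\<And>x S. feasible s k x \<Longrightarrow> (\<Sum>i\<in>{1..n}. max 0 (score s k c m x (S i) - a)) \<le> G S"
    "pexp {1..n} cube (\<lambda>_. P) G \<le> (real n + real s * ln (real k)) / (real s * a)"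
proof
  define C where "C = 2 ^ n * real k ^ s"
  have C: "0 < C" using k by (simp add: C_def)
  let ?G = "\<lambda>S. (1 / C * choice_sum n a S + (ln C - 1)) * (1 / (real s * a))"
  have sa: "0 < real s * a" using s a by simp
  show "(\<Sum>i\<in>{1..n}. max 0 (score s k c m x (S i) - a)) \<le> ?G S" if x: "feasible s k x" for x S
  proof -
    let ?X = "(\<Sum>i\<in>{1..n}. max 0 (score s k c m x (S i) - a))"
    have "1 + (real s * a * ?X - ln C) \<le> exp (real s * a * ?X - ln C)" by (rule exp_ge_add_one_self)
    also have "\<dots> = 1 / C * exp (real s * a * ?X)" using C by (simp add: exp_diff)
    also have "\<dots> \<le> 1 / C * choice_sum n a S"
      using exp_excess_le[OF x less_imp_le[OF a]] C by (intro mult_left_mono) auto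
    finally have "real s * a * ?X \<le> 1 / C * choice_sum n a S + (ln C - 1)" by simp
    then show ?thesis using sa by (simp add: pos_le_divide_eq mult.commute)
  qed
  have "pexp {1..n} cube (\<lambda>_. P) (\<lambda>S. 1 / C * choice_sum n a S + (ln C - 1)) =
      1 / C * pexp {1..n} cube (\<lambda>_. P) (choice_sum n a) + (ln C - 1)"
    using finite_cube P_total by (simp only: pexp_add pexp_cmult) (subst pexp_const; simp)
  also have "\<dots> \<le> 1 / C * C + (ln C - 1)"
    using C choice_sum_expectation[of a n] a unfolding C_def[symmetric]
    by (intro add_right_mono mult_left_mono) auto
  also have "\<dots> = real n * ln 2 + real s * ln (real k)"
    using C k by (simp add: C_def ln_mult ln_realpow)
  also have "\<dots> \<le> real n + real s * ln (real k)"
    using ln_2_less_1 by (simp add: mult_left_le)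
  finally have le: "pexp {1..n} cube (\<lambda>_. P) (\<lambda>S. 1 / C * choice_sum n a S + (ln C - 1)) \<le>
    real n + real s * ln (real k)" .
  have "pexp {1..n} cube (\<lambda>_. P) ?G =
     1 / (real s * a) * pexp {1..n} cube (\<lambda>_. P) (\<lambda>S. 1 / C * choice_sum n a S + (ln C - 1))"
    unfolding pexp_cmult[symmetric] by (simp only: mult.commute)
  also have "\<dots> \<le> 1 / (real s * a) * (real n + real s * ln (real k))"
    using le sa by (intro mult_left_mono) auto
  finally show "pexp {1..n} cube (\<lambda>_. P) ?G \<le> (real n + real s * ln (real k)) / (real s * a)" by simp
qed

end

section \<open>Fingerprinting\<close>

lemma feasible_choice:
  assumes k: "0 < k" and b: "\<And>t. t < s \<Longrightarrow> b t \<in> block k t"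
  shows "feasible s k (\<lambda>j. if j = b (j div k) then 1 / real s else 0)" (is "feasible s k ?y")
    and "(\<Sum>j<s * k. (if j = b (j div k) then 1 / real s else 0) * v j) = (\<Sum>t<s. v (b t)) / real s"
proof -
  have bs: "(\<Sum>j\<in>block k t. ?y j * v j) = v (b t) / real s" if t: "t < s" for t v
  proof -
    have "(\<Sum>j\<in>block k t. ?y j * v j) = (\<Sum>j\<in>block k t. if j = b t then v j / real s else 0)"
    proof (intro sum.cong refl)
      fix j assume "j \<in> block k t"
      then have "j div k = t" using k by (intro div_nat_eqI) (auto simp: mult.commute)
      then show "?y j * v j = (if j = b t then v j / real s else 0)" by simp
    qed
    then show ?thesis using b[OF t] by simp
  qed
  show "feasible s k ?y" using bs[of _ "\<lambda>_. 1"] by (simp add: feasible_def)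
  show "(\<Sum>j<s * k. ?y j * v j) = (\<Sum>t<s. v (b t)) / real s"
    unfolding sum.nat_group[of _ k s, symmetric] using bs[of _ v] by (simp add: sum_divide_distrib)
qed

text \<open>Computed through the complement, whose indicator is a product over the
  coordinates.\<close>

lemma pexp_block_hits:
  assumes k: "0 < k" and t: "t < s" and L: "L \<in> X" and X: "finite X"
    and p: "(\<Sum>x\<in>X. p x) = 1"
  shows "pexp {..<s * k} X (\<lambda>_. p) (\<lambda>l. of_bool (\<exists>j\<in>block k t. l j = L)) = 1 - (1 - p L) ^ k"
proof -
  let ?J = "{..<s * k}"
  let ?f = "\<lambda>j x. if j \<in> block k t \<and> x = L then 0 else (1::real)"
  have prod: "(\<Prod>j\<in>?J. ?f j (l j)) = 1 - of_bool (\<exists>j\<in>block k t. l j = L)" for l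
  proof (cases "\<exists>j\<in>block k t. l j = L")
    case True
    then obtain j where "j \<in> block k t" "l j = L" by auto
    then have "j \<in> ?J" "?f j (l j) = 0" using block_subset[OF t, of k] by auto
    then have "(\<Prod>j\<in>?J. ?f j (l j)) = 0" by (intro prod_zero[OF finite_lessThan] bexI[of _ j])
    then show ?thesis using True by simp
  next
    case False
    then have "(\<Prod>j\<in>?J. ?f j (l j)) = (\<Prod>j\<in>?J. 1)" by (intro prod.cong) auto
    then show ?thesis using False by simp
  qed
  have inner: "(\<Sum>x\<in>X. p x * ?f j x) = (if j \<in> block k t then 1 - p L else 1)" for j
  proof (cases "j \<in> block k t")
    case True
    have "(\<Sum>x\<in>X. p x * ?f j x) = (\<Sum>x\<in>X. p x - (if x = L then p x else 0))"
      using True by (intro sum.cong) auto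
    then show ?thesis using True L X p by (simp add: sum_subtractf)
  next
    case False
    then have "(\<Sum>x\<in>X. p x * ?f j x) = (\<Sum>x\<in>X. p x)" by (intro sum.cong) auto
    then show ?thesis unfolding if_not_P[OF False] using p by (rule trans)
  qed
  have "pexp ?J X (\<lambda>_. p) (\<lambda>l. 1 - of_bool (\<exists>j\<in>block k t. l j = L)) =
      (\<Prod>j\<in>?J. \<Sum>x\<in>X. p x * ?f j x)"
    unfolding prod[symmetric] using X by (intro pexp_prod) auto
  also have "\<dots> = (\<Prod>j\<in>?J. if j \<in> block k t then 1 - p L else 1)" by (simp only: inner)
  also have "\<dots> = (\<Prod>j\<in>block k t. if j \<in> block k t then 1 - p L else 1)"
    using block_subset[OF t, of k] by (intro prod.mono_neutral_right) auto
  also have "\<dots> = (1 - p L) ^ k" by simp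
  finally have "pexp ?J X (\<lambda>_. p) (\<lambda>l. 1 - of_bool (\<exists>j\<in>block k t. l j = L)) = (1 - p L) ^ k" .
  then show ?thesis using X p by (simp add: pexp_diff pexp_const)
qed

text \<open>The expected number of hits \<open>k * p\<close> is at least \<open>sqrt k / 2\<close>,
  hence at least 4. Only 3 is kept, since \<open>2 \<le> exp 1\<close> then gives
  \<open>1 / 8\<close>.\<close>

lemma top_level_missed:
  fixes p :: real
  assumes k: "64 \<le> k" and p: "1 / (2 * sqrt (real k)) \<le> p" "p \<le> 1"
  shows "(1 - p) ^ k \<le> 1 / 8"
proof -
  have sq: "8 \<le> sqrt (real k)" using k real_sqrt_le_mono[of 64 "real k"] by simp
  then have pos: "0 < sqrt (real k)" by linarith
  have "sqrt (real k) / 2 = real k * (1 / (2 * sqrt (real k)))"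
    using pos real_sqrt_mult_self[of "real k"] by (simp add: field_simps)
  also have "\<dots> \<le> real k * p" using p by (intro mult_left_mono) auto
  finally have kp: "3 \<le> real k * p" using sq by linarith
  have "(1 - p) ^ k \<le> exp (- p) ^ k"
    using p exp_ge_add_one_self[of "- p"] by (intro power_mono) auto
  also have "\<dots> = exp (- (real k * p))" by (simp add: exp_of_nat_mult[symmetric])
  also have "\<dots> \<le> exp (- 3)" using kp by simp
  also have "\<dots> = 1 / exp 1 ^ 3" by (simp add: exp_minus inverse_eq_divide exp_of_nat_mult[symmetric])
  also have "\<dots> \<le> 1 / 2 ^ 3"
    using exp_ge_add_one_self[of 1] by (intro divide_left_mono power_mono) auto
  finally show ?thesis by simp
qed

text \<open>The means are random: half of the prior mass is at \<open>0\<close>, and the rest is a geometric tail,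
  truncated at \<open>4 * \<alpha>\<close>, whose rate is chosen so that the truncation value is attained in most
  blocks. A learner therefore puts most of its weight on coordinates with a positive mean, and
  summation by parts against the geometric tail turns this into a correlation with the sample.\<close>

lemma fingerprinting:
  fixes W :: "(nat \<Rightarrow> nat \<Rightarrow> real) \<Rightarrow> nat \<Rightarrow> real"
  assumes s: "0 < s" and k: "64 \<le> k" and \<alpha>: "0 < \<alpha>" "\<alpha> \<le> 1/8"
    and W: "\<And>S. S \<in> {1..n} \<rightarrow>\<^sub>E ({..<s * k} \<rightarrow>\<^sub>E signs) \<Longrightarrow> feasible s k (W S)"
    and learner: "\<And>m y. \<lbrakk>\<And>j. 0 \<le> m j; \<And>j. j < s * k \<Longrightarrow> m j \<le> 1/2; feasible s k y\<rbrakk> \<Longrightarrow>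
      (\<Sum>j<s * k. y j * m j) - \<alpha> \<le>
      pexp {1..n} ({..<s * k} \<rightarrow>\<^sub>E signs) (\<lambda>_. coin {..<s * k} m) (\<lambda>S. \<Sum>j<s * k. W S j * m j)"
  obtains m r where "\<And>j. j < s * k \<Longrightarrow> 0 \<le> m j \<and> m j \<le> 1/2"
    "\<And>j. j < s * k \<Longrightarrow> 0 \<le> r j \<and> r j \<le> 1"
    "ln (real k) / (64 * \<alpha>) \<le> pexp {1..n} ({..<s * k} \<rightarrow>\<^sub>E signs) (\<lambda>_. coin {..<s * k} m)
        (\<lambda>S. \<Sum>i\<in>{1..n}. score s k (\<lambda>j. r j / (1 - (m j)\<^sup>2)) m (W S) (S i))"
proof -
  let ?J = "{..<s * k}" and ?V = "{..<s * k} \<rightarrow>\<^sub>E signs" and ?I = "{1..n}"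
  have k0: "0 < k" and k1: "1 < real k" using k by auto
  have lnk: "0 < ln (real k)" using k1 by simp
  have fV: "finite ?V" by (intro finite_PiE) auto

  \<comment> \<open>The grid only has to be fine enough. The summands secure, in turn,
    \<open>L \<ge> 1\<close>, \<open>x \<le> 1/2\<close>, \<open>2 * n * e \<le> 1\<close>, and a
    second-order error of at most half the main term.\<close>
  obtain L :: nat where L: "1 + ln (real k) + 8 * \<alpha> * real n + 1024 * \<alpha>\<^sup>2 * real (s * k) * (real n)\<^sup>2 / ln (real k) \<le> real L"
    using real_arch_simple by blast
  have nn: "0 \<le> ln (real k)" "0 \<le> 8 * \<alpha> * real n" "0 \<le> 1024 * \<alpha>\<^sup>2 * real (s * k) * (real n)\<^sup>2 / ln (real k)"
    using lnk \<alpha> by auto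
  have L1: "1 \<le> real L" and Lk: "ln (real k) \<le> real L" and Ln: "8 * \<alpha> * real n \<le> real L"
    and Le: "1024 * \<alpha>\<^sup>2 * real (s * k) * (real n)\<^sup>2 / ln (real k) \<le> real L"
    using L nn by linarith+
  have L1': "1 \<le> L" using L1 by simp
  \<comment> \<open>Chosen so that \<open>q ^ L = 1 / sqrt k\<close>: the top level has mass at
    least \<open>1 / (2 * sqrt k)\<close>, while a block has \<open>k\<close> coordinates. The grid
    step \<open>e\<close> puts the top level at the mean \<open>4 * \<alpha>\<close>, which is at
    most \<open>1/2\<close>.\<close>
  define x where "x = ln (real k) / (2 * real L)"
  define q where "q = exp (- x)"
  define e where "e = 4 * \<alpha> / real L"
  define kap where "kap = (1 - q) / q"
  have x: "0 < x" "x \<le> 1/2" using lnk L1 Lk by (auto simp: x_def field_simps)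
  have q: "0 < q" "q < 1" using x by (auto simp: q_def)
  have kap_eq: "kap = exp x - 1" by (simp add: kap_def q_def diff_divide_distrib exp_minus inverse_eq_divide left_diff_distrib)
  have kap_ge: "x \<le> kap" using exp_ge_add_one_self[of x] unfolding kap_eq by linarith
  \<comment> \<open>Keeps the weight \<open>(1 - q) / q\<close> at level 0 within the range required
    of \<open>r\<close>.\<close>
  have kap1: "kap \<le> 1"
  proof -
    have "exp x \<le> 1 + x + x\<^sup>2" using x by (intro exp_bound) auto
    also have "x\<^sup>2 \<le> 1/2 * (1/2)" unfolding power2_eq_square using x by (intro mult_mono) auto
    finally show ?thesis using x by (simp add: kap_eq)
  qed
  have e: "0 < e" "2 * real n * e \<le> 1"
    using \<alpha> L1 Ln by (auto simp: e_def field_simps)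
  have eL: "e * real L = 4 * \<alpha>" using L1 by (simp add: e_def)
  let ?p = "level_prior L q"
  let ?E = "pexp ?J {0..L} (\<lambda>_. ?p)"
  have p_sum: "(\<Sum>l\<in>{0..L}. ?p l) = 1" by (rule level_prior_sum[OF q L1'])
  have p_nn: "0 \<le> ?p l" for l by (rule level_prior_nonneg[OF q])

  define mu where "mu l = (\<lambda>j. e * real (l j))" for l :: "nat \<Rightarrow> nat"
  define G where "G l F = pexp ?I ?V (\<lambda>_. coin ?J (mu l)) F" for l F
  define H where "H l j = G l (\<lambda>S. W S j * (\<Sum>i\<in>?I. (S i j - mu l j) / (1 - (mu l j)\<^sup>2)))" for l j
  have mu_nn: "0 \<le> mu l j" for l j using e by (simp add: mu_def)
  have mu_le: "mu l j \<le> 4 * \<alpha>" if "l \<in> ?J \<rightarrow>\<^sub>E {0..L}" "j \<in> ?J" for l j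
  proof -
    have "l j \<le> L" using that by (auto simp: PiE_iff)
    then show ?thesis unfolding mu_def eL[symmetric] using e by (intro mult_left_mono) auto
  qed
  have W0: "0 \<le> W S j" if "S \<in> ?I \<rightarrow>\<^sub>E ?V" "j \<in> ?J" for S j
    using W[OF that(1)] that(2) by (auto simp: feasible_def)
  have Wsum: "(\<Sum>j\<in>?J. W S j) = 1" if "S \<in> ?I \<rightarrow>\<^sub>E ?V" for S
    using feasible_sum[OF W[OF that] s] .
  have W1: "W S j \<le> 1" if "S \<in> ?I \<rightarrow>\<^sub>E ?V" "j \<in> ?J" for S j
    using member_le_sum[of j ?J "W S"] Wsum[OF that(1)] W0[OF that(1)] that(2) by auto

  \<comment> \<open>The weight is at most 1, so the second-order error is not amplified; at
    \<open>l j = L\<close> it is 0, which removes the shift beyond the grid.\<close>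
  have deriv: "?E (\<lambda>l. level_weight L q (l j) * (G (l(j := Suc (l j))) (\<lambda>S. W S j) - G l (\<lambda>S. W S j)))
      \<le> ?E (\<lambda>l. e * (level_weight L q (l j) * H l j) + (2 * real n * e)\<^sup>2)" if j: "j \<in> ?J" for j
  proof (rule pexp_mono)
    fix l assume l: "l \<in> ?J \<rightarrow>\<^sub>E {0..L}"
    have w: "0 \<le> level_weight L q (l j)" "level_weight L q (l j) \<le> 1"
      using kap1 kap_ge x by (auto simp: level_weight_def kap_def)
    have upd: "mu (l(j := Suc (l j))) = (mu l)(j := mu l j + e)"
      by (auto simp: mu_def algebra_simps)
    have "G (l(j := Suc (l j))) (\<lambda>S. W S j) - G l (\<lambda>S. W S j) \<le> e * H l j + (2 * real n * e)\<^sup>2"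
      unfolding G_def H_def upd
    proof (rule coin_sample_shift)
      show "\<bar>mu l i\<bar> \<le> 1" if "i \<in> ?J" for i
        using mu_nn[of l i] mu_le[OF l that] \<alpha> by simp
      show "mu l j \<le> 1/2" using mu_le[OF l j] \<alpha> by simp
      show "\<bar>W S j\<bar> \<le> 1" if "S \<in> ?I \<rightarrow>\<^sub>E ?V" for S using W0[OF that j] W1[OF that j] by simp
    qed (use j mu_nn e in auto)
    then have "level_weight L q (l j) * (G (l(j := Suc (l j))) (\<lambda>S. W S j) - G l (\<lambda>S. W S j)) \<le>
        level_weight L q (l j) * (e * H l j + (2 * real n * e)\<^sup>2)"
      using w by (intro mult_left_mono)
    also have "\<dots> \<le> e * (level_weight L q (l j) * H l j) + (2 * real n * e)\<^sup>2"
      using mult_right_mono[OF w(2), of "(2 * real n * e)\<^sup>2"] by (simp add: distrib_left mult.left_commute)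
    finally show "level_weight L q (l j) * (G (l(j := Suc (l j))) (\<lambda>S. W S j) - G l (\<lambda>S. W S j)) \<le>
        e * (level_weight L q (l j) * H l j) + (2 * real n * e)\<^sup>2" .
  qed (rule p_nn)

  have "kap * ?E (\<lambda>l. \<Sum>j\<in>?J. level_sign (l j) * G l (\<lambda>S. W S j)) =
      (\<Sum>j\<in>?J. kap * ?E (\<lambda>l. level_sign (l j) * G l (\<lambda>S. W S j)))"
    by (simp add: pexp_sum sum_distrib_left)
  also have "\<dots> = (\<Sum>j\<in>?J. ?E (\<lambda>l. level_weight L q (l j) *
      (G (l(j := Suc (l j))) (\<lambda>S. W S j) - G l (\<lambda>S. W S j))))"
    unfolding kap_def using q L1'
    by (intro sum.cong refl pexp_summation_by_parts[where F = "\<lambda>l. G l (\<lambda>S. W S j)" for j, symmetric]) auto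
  also have "\<dots> \<le> (\<Sum>j\<in>?J. ?E (\<lambda>l. e * (level_weight L q (l j) * H l j) + (2 * real n * e)\<^sup>2))"
    by (intro sum_mono deriv)
  also have "\<dots> = e * ?E (\<lambda>l. \<Sum>j\<in>?J. level_weight L q (l j) * H l j) + real (s * k) * (2 * real n * e)\<^sup>2"
    using p_sum by (simp add: pexp_add pexp_cmult pexp_sum pexp_const sum.distrib sum_distrib_left)
  finally have upper: "kap * ?E (\<lambda>l. \<Sum>j\<in>?J. level_sign (l j) * G l (\<lambda>S. W S j)) \<le>
     e * ?E (\<lambda>l. \<Sum>j\<in>?J. level_weight L q (l j) * H l j) + real (s * k) * (2 * real n * e)\<^sup>2" .

  \<comment> \<open>\<open>1/4 = 2 * 7/8 - 3/2\<close>. Each block attains the top level with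
    probability at least \<open>7/8\<close>. The \<open>3/2\<close> is \<open>3 * \<alpha>\<close>
    over \<open>2 * \<alpha>\<close>: the learner's error \<alpha>, plus the shift
    \<open>2 * \<alpha>\<close> in writing the cap \<open>4 * \<alpha>\<close> on positive levels as
    \<open>2 * \<alpha> * (level_sign (l j) + 1)\<close>.\<close>
  have "1/4 \<le> ?E (\<lambda>l. 2 / real s * (\<Sum>t<s. of_bool (\<exists>j\<in>block k t. l j = L)) - 3/2)"
  proof -
    have pL: "?p L = q ^ (L - 1) / 2" using L1' by (simp add: level_prior_def)
    have "1 / sqrt (real k) = q ^ L"
    proof -
      have "real L * - x = - (ln (real k) / 2)" using L1 by (simp add: x_def)
      then have "q ^ L = exp (- (ln (real k) / 2))"
        by (simp add: q_def exp_of_nat_mult[symmetric])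
      also have "\<dots> = 1 / sqrt (real k)" using k1
        by (simp add: exp_minus inverse_eq_divide ln_sqrt[symmetric])
      finally show ?thesis by simp
    qed
    also have "\<dots> \<le> q ^ (L - 1)" using q by (intro power_decreasing) auto
    finally have "1 / (2 * sqrt (real k)) \<le> ?p L" by (simp add: pL)
    moreover have "?p L \<le> 1" using q power_le_one[of q "L - 1"] by (simp add: pL)
    ultimately have "(1 - ?p L) ^ k \<le> 1/8" by (rule top_level_missed[OF k])
    then have hit: "7/8 \<le> ?E (\<lambda>l. of_bool (\<exists>j\<in>block k t. l j = L))" if "t < s" for t
      using pexp_block_hits[OF k0 that, of L "{0..L}" ?p] p_sum by simp
    have "(\<Sum>t<s. 7/8) \<le> (\<Sum>t<s. ?E (\<lambda>l. of_bool (\<exists>j\<in>block k t. l j = L)))"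
      by (intro sum_mono hit) simp
    then have "7/8 * real s \<le> (\<Sum>t<s. ?E (\<lambda>l. of_bool (\<exists>j\<in>block k t. l j = L)))"
      by (simp only: sum_constant card_lessThan mult.commute)
    then have "2 / real s * (7/8 * real s) \<le> 2 / real s * (\<Sum>t<s. ?E (\<lambda>l. of_bool (\<exists>j\<in>block k t. l j = L)))"
      by (intro mult_left_mono) auto
    moreover have "?E (\<lambda>l. 2 / real s * (\<Sum>t<s. of_bool (\<exists>j\<in>block k t. l j = L)) - 3/2) =
        2 / real s * (\<Sum>t<s. ?E (\<lambda>l. of_bool (\<exists>j\<in>block k t. l j = L))) - 3/2"
      unfolding pexp_diff pexp_cmult pexp_sum using p_sum by (simp only: pexp_const finite_lessThan finite_atLeastAtMost)
    moreover have "2 / real s * (7/8 * real s) = 7/4" using s by simp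
    ultimately show ?thesis by linarith
  qed
  also have "\<dots> \<le> ?E (\<lambda>l. \<Sum>j\<in>?J. level_sign (l j) * G l (\<lambda>S. W S j))"
  proof (rule pexp_mono)
    fix l assume l: "l \<in> ?J \<rightarrow>\<^sub>E {0..L}"
    \<comment> \<open>The comparison vertex takes a top-level coordinate in every block that has
      one; elsewhere any coordinate of the block serves.\<close>
    have "\<exists>i\<in>block k t. (\<exists>j\<in>block k t. l j = L) \<longrightarrow> l i = L" for t
    proof (cases "\<exists>j\<in>block k t. l j = L")
      case False
      then show ?thesis using k0 by (intro bexI[of _ "t * k"]) auto
    qed blast
    then obtain b where b: "b t \<in> block k t" "(\<exists>j\<in>block k t. l j = L) \<Longrightarrow> l (b t) = L" for t
      by metis
    define y where "y j = (if j = b (j div k) then 1 / real s else 0)" for j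
    have y: "feasible s k y" "(\<Sum>j\<in>?J. y j * mu l j) = (\<Sum>t<s. mu l (b t)) / real s"
      unfolding y_def by (rule feasible_choice[OF k0]; use b in blast)+
    have "(\<Sum>t<s. 4 * \<alpha> * of_bool (\<exists>j\<in>block k t. l j = L)) \<le> (\<Sum>t<s. mu l (b t))"
    proof (intro sum_mono)
      fix t show "4 * \<alpha> * of_bool (\<exists>j\<in>block k t. l j = L) \<le> mu l (b t)"
      proof (cases "\<exists>j\<in>block k t. l j = L")
        case True
        then have "l (b t) = L" by (rule b(2))
        then show ?thesis using True eL by (simp add: mu_def)
      qed (use mu_nn in auto)
    qed
    then have "(\<Sum>t<s. 4 * \<alpha> * of_bool (\<exists>j\<in>block k t. l j = L)) / real s \<le> (\<Sum>j\<in>?J. y j * mu l j)"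
      unfolding y by (intro divide_right_mono) auto
    also have "\<dots> \<le> G l (\<lambda>S. \<Sum>j\<in>?J. W S j * mu l j) + \<alpha>"
    proof -
      have "mu l j \<le> 1/2" if "j < s * k" for j using mu_le[OF l, of j] that \<alpha> by simp
      then show ?thesis using learner[of "mu l" y] y(1) mu_nn unfolding G_def by force
    qed
    also have "G l (\<lambda>S. \<Sum>j\<in>?J. W S j * mu l j) \<le>
        G l (\<lambda>S. 2 * \<alpha> * (\<Sum>j\<in>?J. level_sign (l j) * W S j) + 2 * \<alpha>)"
      unfolding G_def
    proof (rule pexp_mono)
      fix S assume S: "S \<in> ?I \<rightarrow>\<^sub>E ?V"
      have "(\<Sum>j\<in>?J. W S j * mu l j) \<le> (\<Sum>j\<in>?J. 2 * \<alpha> * (level_sign (l j) * W S j) + 2 * \<alpha> * W S j)"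
      proof (intro sum_mono)
        fix j assume j: "j \<in> ?J"
        have "W S j * mu l j \<le> W S j * (4 * \<alpha>)"
          using mu_le[OF l j] W0[OF S j] by (intro mult_left_mono)
        then show "W S j * mu l j \<le> 2 * \<alpha> * (level_sign (l j) * W S j) + 2 * \<alpha> * W S j"
          by (cases "l j = 0") (auto simp: level_sign_def mu_def mult_ac)
      qed
      also have "\<dots> = 2 * \<alpha> * (\<Sum>j\<in>?J. level_sign (l j) * W S j) + 2 * \<alpha>"
        using Wsum[OF S] by (simp add: sum.distrib sum_distrib_left[symmetric])
      finally show "(\<Sum>j\<in>?J. W S j * mu l j) \<le> 2 * \<alpha> * (\<Sum>j\<in>?J. level_sign (l j) * W S j) + 2 * \<alpha>" .
    next
      fix z assume "z \<in> ?V"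
      then show "0 \<le> coin ?J (mu l) z"
        using mu_nn[of l] mu_le[OF l] \<alpha> by (intro coin_nonneg) fastforce+
    qed
    also have "\<dots> = 2 * \<alpha> * (\<Sum>j\<in>?J. level_sign (l j) * G l (\<lambda>S. W S j)) + 2 * \<alpha>"
      unfolding G_def using fV by (simp add: pexp_add pexp_cmult pexp_sum pexp_const coin_total)
    finally have "(\<Sum>t<s. 4 * \<alpha> * of_bool (\<exists>j\<in>block k t. l j = L)) / real s \<le>
        2 * \<alpha> * (\<Sum>j\<in>?J. level_sign (l j) * G l (\<lambda>S. W S j)) + 2 * \<alpha> + \<alpha>" by simp
    also have "(\<Sum>t<s. 4 * \<alpha> * of_bool (\<exists>j\<in>block k t. l j = L)) / real s =
        2 * \<alpha> * (2 / real s * (\<Sum>t<s. of_bool (\<exists>j\<in>block k t. l j = L)))"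
      unfolding sum_distrib_left[symmetric] by simp
    finally have "2 * \<alpha> * (2 / real s * (\<Sum>t<s. of_bool (\<exists>j\<in>block k t. l j = L))) \<le>
        2 * \<alpha> * ((\<Sum>j\<in>?J. level_sign (l j) * G l (\<lambda>S. W S j)) + 3/2)"
      by (simp add: distrib_left)
    then show "2 / real s * (\<Sum>t<s. of_bool (\<exists>j\<in>block k t. l j = L)) - 3/2 \<le>
        (\<Sum>j\<in>?J. level_sign (l j) * G l (\<lambda>S. W S j))"
      using \<alpha> by (simp only: mult_le_cancel_left_pos mult_pos_pos zero_less_numeral)
  qed (rule p_nn)
  finally have lower: "1/4 \<le> ?E (\<lambda>l. \<Sum>j\<in>?J. level_sign (l j) * G l (\<lambda>S. W S j))" .

  \<comment> \<open>Divided by the grid step \<open>e\<close>, the gain \<open>x / 4\<close> becomes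
    \<open>ln k / (32 * \<alpha>)\<close>; half of it pays for the second-order error.\<close>
  have "ln (real k) / (64 * \<alpha>) \<le> ?E (\<lambda>l. \<Sum>j\<in>?J. level_weight L q (l j) * H l j)"
  proof -
    have "x * (1/4) \<le> kap * (1/4)" using kap_ge by simp
    also have "\<dots> \<le> kap * ?E (\<lambda>l. \<Sum>j\<in>?J. level_sign (l j) * G l (\<lambda>S. W S j))"
      using lower kap_ge x by (intro mult_left_mono) auto
    finally have "x / 4 - real (s * k) * (2 * real n * e)\<^sup>2 \<le>
        e * ?E (\<lambda>l. \<Sum>j\<in>?J. level_weight L q (l j) * H l j)" using upper by simp
    moreover have "x / 4 = e * (ln (real k) / (32 * \<alpha>))"
      using \<alpha> L1 by (simp add: x_def e_def)
    moreover have "real (s * k) * (2 * real n * e)\<^sup>2 \<le> e * (ln (real k) / (64 * \<alpha>))"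
    proof -
      have "1024 * \<alpha>\<^sup>2 * real (s * k) * (real n)\<^sup>2 \<le> real L * ln (real k)"
        using Le lnk by (simp add: pos_divide_le_eq)
      then have "1024 * \<alpha>\<^sup>2 * real (s * k) * (real n)\<^sup>2 / (64 * \<alpha> * real L) \<le> real L * ln (real k) / (64 * \<alpha> * real L)"
        using \<alpha> L1 by (intro divide_right_mono) auto
      moreover have "1024 * \<alpha>\<^sup>2 * real (s * k) * (real n)\<^sup>2 / (64 * \<alpha> * real L) = real (s * k) * (4 * (real n)\<^sup>2 * e)"
        using \<alpha> L1 by (simp add: e_def power2_eq_square field_simps)
      moreover have "real L * ln (real k) / (64 * \<alpha> * real L) = ln (real k) / (64 * \<alpha>)"
        using L1 by simp
      ultimately have "real (s * k) * (4 * (real n)\<^sup>2 * e) \<le> ln (real k) / (64 * \<alpha>)" by simp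
      then have "e * (real (s * k) * (4 * (real n)\<^sup>2 * e)) \<le> e * (ln (real k) / (64 * \<alpha>))"
        using e by (intro mult_left_mono) auto
      then show ?thesis by (simp add: power2_eq_square mult_ac)
    qed
    moreover have "e * (ln (real k) / (32 * \<alpha>)) = e * (ln (real k) / (64 * \<alpha>)) + e * (ln (real k) / (64 * \<alpha>))"
      using \<alpha> by (simp add: field_simps)
    ultimately have "e * (ln (real k) / (64 * \<alpha>)) \<le> e * ?E (\<lambda>l. \<Sum>j\<in>?J. level_weight L q (l j) * H l j)"
      by linarith
    then show ?thesis using e by (simp only: mult_le_cancel_left_pos)
  qed
  then have "\<exists>l\<in>?J \<rightarrow>\<^sub>E {0..L}. ln (real k) / (64 * \<alpha>) \<le> (\<Sum>j\<in>?J. level_weight L q (l j) * H l j)"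
    using p_sum p_nn by (intro pexp_exists_ge[where p = "\<lambda>_. ?p"]) simp_all
  then obtain l where l: "l \<in> ?J \<rightarrow>\<^sub>E {0..L}"
    and ge: "ln (real k) / (64 * \<alpha>) \<le> (\<Sum>j\<in>?J. level_weight L q (l j) * H l j)"
    by blast
  show ?thesis
  proof (rule that[of "mu l" "\<lambda>j. level_weight L q (l j)"])
    show "0 \<le> mu l j \<and> mu l j \<le> 1/2" if "j < s * k" for j
      using mu_nn[of l j] mu_le[OF l, of j] \<alpha> that by simp
    show "0 \<le> level_weight L q (l j) \<and> level_weight L q (l j) \<le> 1" for j
      using kap1 kap_ge x by (auto simp: level_weight_def kap_def)
    have "(\<Sum>j\<in>?J. level_weight L q (l j) * H l j) = pexp ?I ?V (\<lambda>_. coin ?J (mu l))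
      (\<lambda>S. \<Sum>i\<in>?I. score s k (\<lambda>j. level_weight L q (l j) / (1 - (mu l j)\<^sup>2)) (mu l) (W S) (S i))"
      unfolding H_def G_def pexp_cmult[symmetric] pexp_sum[symmetric]
    proof (rule pexp_cong)
      fix S
      have "(\<Sum>i\<in>?I. score s k (\<lambda>j. level_weight L q (l j) / (1 - (mu l j)\<^sup>2)) (mu l) (W S) (S i)) =
        (\<Sum>j\<in>?J. \<Sum>i\<in>?I. W S j * (level_weight L q (l j) / (1 - (mu l j)\<^sup>2) * (S i j - mu l j)))"
        unfolding score_def by (rule sum.swap)
      also have "\<dots> = (\<Sum>j\<in>?J. level_weight L q (l j) * (W S j * (\<Sum>i\<in>?I. (S i j - mu l j) / (1 - (mu l j)\<^sup>2))))"
        unfolding sum_distrib_left by (intro sum.cong refl) (simp add: mult_ac)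
      finally show "(\<Sum>j\<in>?J. level_weight L q (l j) * (W S j * (\<Sum>i\<in>?I. (S i j - mu l j) / (1 - (mu l j)\<^sup>2)))) =
        (\<Sum>i\<in>?I. score s k (\<lambda>j. level_weight L q (l j) / (1 - (mu l j)\<^sup>2)) (mu l) (W S) (S i))" by simp
    qed
    then show "ln (real k) / (64 * \<alpha>) \<le> pexp ?I ?V (\<lambda>_. coin ?J (mu l))
      (\<lambda>S. \<Sum>i\<in>?I. score s k (\<lambda>j. level_weight L q (l j) / (1 - (mu l j)\<^sup>2)) (mu l) (W S) (S i))"
      using ge by simp
  qed
qed

section \<open>The hard problem\<close>

text \<open>Both binds are resolved by the integral formula for kernels. Boundedness of
  \<open>h\<close> stands in for integrability and covers the two uses, an event and a
  count.\<close>

lemma integral_tracing_law: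
  fixes h :: "(nat \<Rightarrow> 'z) \<times> rvec \<Rightarrow> real"
  assumes D: "D \<in> space (prob_algebra Z)"
    and A: "A \<in> (\<Pi>\<^sub>M i\<in>{1..n}. Z) \<rightarrow>\<^sub>M prob_algebra (param_space d \<Theta>)"
    and h: "h \<in> borel_measurable ((\<Pi>\<^sub>M i\<in>{0..n}. Z) \<Otimes>\<^sub>M param_space d \<Theta>)"
    and bound: "\<And>x. \<bar>h x\<bar> \<le> B"
  shows "(\<integral>x. h x \<partial>tracing_law d n \<Theta> D A) =
    (\<integral>z. (\<integral>\<theta>. h (z, \<theta>) \<partial>A (restrict z {1..n})) \<partial>(\<Pi>\<^sub>M i\<in>{0..n}. D))"
proof -
  let ?N = "\<Pi>\<^sub>M i\<in>{0..n}. D" and ?T = "param_space d \<Theta>"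
  let ?R = "?N \<Otimes>\<^sub>M ?T"
  have sD: "sets D = sets Z" and pD: "prob_space D" using D by (auto simp: space_prob_algebra)
  have sN: "sets (\<Pi>\<^sub>M i\<in>I. D) = sets (\<Pi>\<^sub>M i\<in>I. Z)" for I :: "nat set"
    using sD by (intro sets_PiM_cong) auto
  interpret N: prob_space ?N using pD by (intro prob_space_PiM)
  have sR: "sets ?R = sets ((\<Pi>\<^sub>M i\<in>{0..n}. Z) \<Otimes>\<^sub>M ?T)"
    using sN by (intro sets_pair_measure_cong) auto
  have hR: "h \<in> borel_measurable ?R" using h measurable_cong_sets[OF sR refl] by blast
  have "(\<lambda>z. restrict z {1..n}) \<in> ?N \<rightarrow>\<^sub>M (\<Pi>\<^sub>M i\<in>{1..n}. D)"
    by (intro measurable_restrict_subset) auto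
  then have "(\<lambda>z. restrict z {1..n}) \<in> ?N \<rightarrow>\<^sub>M (\<Pi>\<^sub>M i\<in>{1..n}. Z)"
    using measurable_cong_sets[OF refl sN] by blast
  then have K: "(\<lambda>z. A (restrict z {1..n})) \<in> ?N \<rightarrow>\<^sub>M prob_algebra ?T"
    using A by (rule measurable_compose)
  then have Ks: "(\<lambda>z. A (restrict z {1..n})) \<in> ?N \<rightarrow>\<^sub>M subprob_algebra ?T"
    by (rule measurable_prob_algebraD)
  let ?g = "\<lambda>z \<theta>. return ?R (z, \<theta>)"
  have g: "case_prod ?g \<in> ?R \<rightarrow>\<^sub>M subprob_algebra ?R" by simp
  let ?K = "\<lambda>z. A (restrict z {1..n}) \<bind> ?g z"
  have KR: "?K \<in> ?N \<rightarrow>\<^sub>M subprob_algebra ?R"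
    by (rule measurable_bind'[OF Ks g])
  have law: "tracing_law d n \<Theta> D A = ?N \<bind> ?K" by (simp add: tracing_law_def)
  have inner: "(\<integral>x. h x \<partial>?K z) = (\<integral>\<theta>. h (z, \<theta>) \<partial>A (restrict z {1..n}))" if z: "z \<in> space ?N" for z
  proof -
    have Az: "A (restrict z {1..n}) \<in> space (prob_algebra ?T)" using measurable_space[OF K z] .
    then have pA: "prob_space (A (restrict z {1..n}))" and sA: "sets (A (restrict z {1..n})) = sets ?T"
      by (auto simp: space_prob_algebra)
    interpret A: prob_space "A (restrict z {1..n})" by (rule pA)
    have gz: "?g z \<in> A (restrict z {1..n}) \<rightarrow>\<^sub>M subprob_algebra ?R"
      unfolding measurable_cong_sets[OF sA refl] using measurable_compose[OF measurable_Pair1'[OF z] g] by simp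
    have "(\<integral>x. h x \<partial>?K z) = (\<integral>\<theta>. (\<integral>x. h x \<partial>?g z \<theta>) \<partial>A (restrict z {1..n}))"
    proof (rule integral_bind[OF hR _ gz, where B' = 1 and B = B])
      show "AE x in A (restrict z {1..n}). emeasure (?g z x) (space (?g z x)) \<le> ennreal 1"
        unfolding ennreal_1 by (intro AE_I2 subprob_space.emeasure_space_le_1 subprob_space_kernel[OF gz])
    qed (rule bound A.finite_measure_axioms)+
    also have "\<dots> = (\<integral>\<theta>. h (z, \<theta>) \<partial>A (restrict z {1..n}))"
    proof (intro Bochner_Integration.integral_cong refl)
      fix \<theta> assume "\<theta> \<in> space (A (restrict z {1..n}))"
      then have "(z, \<theta>) \<in> space ?R" using z sets_eq_imp_space_eq[OF sA] by (simp add: space_pair_measure)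
      then show "(\<integral>x. h x \<partial>?g z \<theta>) = h (z, \<theta>)" using hR by (rule integral_return)
    qed
    finally show ?thesis .
  qed
  have "(\<integral>x. h x \<partial>(?N \<bind> ?K)) = (\<integral>z. (\<integral>x. h x \<partial>?K z) \<partial>?N)"
  proof (rule integral_bind[OF hR _ KR, where B' = 1 and B = B])
    show "AE z in ?N. emeasure (?K z) (space (?K z)) \<le> ennreal 1"
      unfolding ennreal_1 by (intro AE_I2 subprob_space.emeasure_space_le_1 subprob_space_kernel[OF KR])
  qed (rule bound N.finite_measure_axioms)+
  also have "\<dots> = (\<integral>z. (\<integral>\<theta>. h (z, \<theta>) \<partial>A (restrict z {1..n})) \<partial>?N)"
    by (intro Bochner_Integration.integral_cong refl inner)
  finally show ?thesis by (simp only: law)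
qed

lemma coin_mean:
  assumes J: "finite J" "j \<in> J"
  shows "(\<Sum>z\<in>J \<rightarrow>\<^sub>E signs. coin J m z * z j) = m j"
proof -
  have "(\<Sum>z\<in>J \<rightarrow>\<^sub>E signs. coin J m z * z j) =
      pexp J signs (\<lambda>j. bern (m j)) (\<lambda>z. \<Prod>i\<in>J. if i = j then z i else 1)"
    unfolding sum_coin using J by simp
  also have "\<dots> = (\<Prod>i\<in>J. \<Sum>y\<in>signs. bern (m i) y * (if i = j then y else 1))"
    using J by (intro pexp_prod[where f = "\<lambda>i y. if i = j then y else 1"]) auto
  also have "\<dots> = (\<Prod>i\<in>J. if i = j then m i else 1)"
    by (intro prod.cong refl) (auto simp: bern_def field_simps)
  also have "\<dots> = m j" using J by simp
  finally show ?thesis .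
qed

lemma feasible_cong:
  assumes "\<And>j. j < s * k \<Longrightarrow> x j = y j"
  shows "feasible s k x \<longleftrightarrow> feasible s k y"
proof -
  have "(\<Sum>j\<in>block k t. x j) = (\<Sum>j\<in>block k t. y j)" if "t < s" for t
    using block_subset[OF that, of k] assms by (intro sum.cong) auto
  then show ?thesis using assms by (auto simp: feasible_def)
qed

section \<open>The parameter polytope and the linear loss\<close>

text \<open>Since \<open>s * k\<close> may be smaller than \<open>d\<close>, the leftover
  coordinates are pinned at 0; for \<open>0 < s\<close> and \<open>s * k \<le> d\<close> every
  parameter then has l1 norm exactly 1.\<close>

definition params :: "nat \<Rightarrow> nat \<Rightarrow> nat \<Rightarrow> rvec set" where
  "params d s k = {x \<in> space (euclid d). feasible s k x \<and> (\<forall>j\<in>{s * k..<d}. x j = 0)}"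

definition lin_loss :: "nat \<Rightarrow> rvec \<Rightarrow> (nat \<Rightarrow> real) \<Rightarrow> real" where
  "lin_loss N x z = - (\<Sum>j<N. x j * z j)"

definition hard_problem :: "nat \<Rightarrow> nat \<Rightarrow> nat \<Rightarrow> (nat \<Rightarrow> real) sco" where
  "hard_problem d s k = (params d s k, count_space ({..<s * k} \<rightarrow>\<^sub>E signs), lin_loss (s * k))"

lemma params_embed:
  assumes "feasible s k y" "s * k \<le> d"
  shows "(\<lambda>j\<in>{..<d}. if j < s * k then y j else 0) \<in> params d s k"
proof -
  have "feasible s k (\<lambda>j\<in>{..<d}. if j < s * k then y j else 0)"
    using assms by (subst feasible_cong[of s k _ y]) auto
  then show ?thesis by (auto simp: params_def euclid_def space_PiM)
qed

lemma lin_loss_bound: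
  assumes x: "feasible s k x" and s: "0 < s" and z: "z \<in> {..<s * k} \<rightarrow>\<^sub>E signs"
  shows "\<bar>lin_loss (s * k) x z\<bar> \<le> 1"
proof -
  have "\<bar>lin_loss (s * k) x z\<bar> \<le> (\<Sum>j<s * k. \<bar>x j * z j\<bar>)"
    unfolding lin_loss_def abs_minus_cancel by (rule sum_abs)
  also have "\<dots> = (\<Sum>j<s * k. x j)"
  proof (intro sum.cong refl)
    fix j assume j: "j \<in> {..<s * k}"
    then have "z j \<in> signs" using z by (auto simp: PiE_iff)
    then show "\<bar>x j * z j\<bar> = x j" using x j by (auto simp: feasible_def abs_mult)
  qed
  finally show ?thesis using feasible_sum[OF x s] by simp
qed

lemma params_convex:
  assumes "s * k \<le> d"
  shows "convex_set d (params d s k)"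
  unfolding convex_set_def
proof (intro ballI)
  fix x y and t :: real assume x: "x \<in> params d s k" and y: "y \<in> params d s k" and t: "t \<in> {0..1}"
  let ?w = "\<lambda>j. (1 - t) * x j + t * y j"
  have "(\<Sum>j\<in>block k b. ?w j) = 1 / real s" if "b < s" for b
  proof -
    have "(\<Sum>j\<in>block k b. ?w j) = (1 - t) * (\<Sum>j\<in>block k b. x j) + t * (\<Sum>j\<in>block k b. y j)"
      by (simp add: sum.distrib sum_distrib_left)
    also have "\<dots> = (1 - t) * (1 / real s) + t * (1 / real s)"
      using x y that by (simp add: params_def feasible_def)
    also have "\<dots> = 1 / real s" by (simp add: add_divide_distrib[symmetric])
    finally show ?thesis .
  qed
  moreover have "0 \<le> ?w j" if "j < s * k" for j
    using x y t that by (simp add: params_def feasible_def)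
  ultimately have "feasible s k ?w" by (simp add: feasible_def)
  then have "feasible s k (conv_comb d t x y)"
    using assms by (subst feasible_cong[of s k _ ?w]) (auto simp: conv_comb_def)
  then show "conv_comb d t x y \<in> params d s k"
    using x y by (auto simp: params_def conv_comb_def euclid_def space_PiM)
qed

lemma params_subset_ball:
  assumes "s * k \<le> d" "0 < s"
  shows "params d s k \<subseteq> l1_ball d 1"
proof
  fix x assume x: "x \<in> params d s k"
  have "l1_norm d x = (\<Sum>j<s * k. \<bar>x j\<bar>)"
    unfolding l1_norm_def using assms(1) x
    by (intro sum.mono_neutral_right) (auto simp: params_def)
  also have "\<dots> = (\<Sum>j<s * k. x j)"
    using x by (intro sum.cong) (auto simp: params_def feasible_def)
  also have "\<dots> = 1" using x assms(2) by (intro feasible_sum) (auto simp: params_def)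
  finally show "x \<in> l1_ball d 1" using x by (simp add: l1_ball_def params_def)
qed

lemma lin_loss_conv_comb:
  assumes "N \<le> d"
  shows "lin_loss N (conv_comb d t x y) z = (1 - t) * lin_loss N x z + t * lin_loss N y z"
proof -
  have "(\<Sum>j<N. conv_comb d t x y j * z j) = (\<Sum>j<N. (1 - t) * (x j * z j) + t * (y j * z j))"
    using assms by (intro sum.cong) (auto simp: conv_comb_def algebra_simps)
  then show ?thesis
    unfolding lin_loss_def sum.distrib sum_distrib_left[symmetric] by simp
qed

lemma lin_loss_Lipschitz:
  assumes N: "N \<le> d" and z: "z \<in> {..<N} \<rightarrow>\<^sub>E signs"
  shows "\<bar>lin_loss N x z - lin_loss N y z\<bar> \<le> l1_dist d x y"
proof -
  have "\<bar>lin_loss N x z - lin_loss N y z\<bar> = \<bar>\<Sum>j<N. (y j - x j) * z j\<bar>"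
    by (simp add: lin_loss_def left_diff_distrib sum_subtractf)
  also have "\<dots> \<le> (\<Sum>j<N. \<bar>(y j - x j) * z j\<bar>)" by (rule sum_abs)
  also have "\<dots> = (\<Sum>j<N. \<bar>x j - y j\<bar>)"
  proof (intro sum.cong refl)
    fix j assume "j \<in> {..<N}"
    then have "z j \<in> signs" using z by (auto simp: PiE_iff)
    then show "\<bar>(y j - x j) * z j\<bar> = \<bar>x j - y j\<bar>" by (auto simp: abs_mult)
  qed
  also have "\<dots> \<le> (\<Sum>j<d. \<bar>x j - y j\<bar>)" using N by (intro sum_mono2) auto
  finally show ?thesis by (simp add: l1_dist_def l1_norm_def)
qed

text \<open>On the finite discrete cube every loss is measurable, and its bound 1 makes it
  integrable under every law. Linearity gives convexity, and data entries of absolute value 1 give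
  the Lipschitz constant.\<close>

lemma hard_problem_l1_sco:
  assumes s: "0 < s" and k: "0 < k" and d: "s * k \<le> d"
  shows "hard_problem d s k \<in> l1_sco d"
proof -
  let ?V = "{..<s * k} \<rightarrow>\<^sub>E signs"
  have ne: "params d s k \<noteq> {}"
    using params_embed[OF feasible_choice(1)[OF k, of s "\<lambda>t. t * k"] d] k by auto
  have int: "integrable D (lin_loss (s * k) x)"
    if D: "D \<in> space (prob_algebra (count_space ?V))" and x: "x \<in> params d s k" for D x
  proof -
    have sD: "sets D = sets (count_space ?V)" and "prob_space D" using D by (auto simp: space_prob_algebra)
    then interpret D: prob_space D by simp
    have sp: "space D = ?V" using sets_eq_imp_space_eq[OF sD] by simp
    have meas: "lin_loss (s * k) x \<in> borel_measurable D"
      unfolding measurable_cong_sets[OF sD refl] by simp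
    have x': "feasible s k x" using x by (simp add: params_def)
    show ?thesis
    proof (rule D.integrable_const_bound[OF AE_I2 meas])
      show "norm (lin_loss (s * k) x z) \<le> 1" if "z \<in> space D" for z
        using lin_loss_bound[OF x' s] that sp by simp
    qed
  qed
  have "convex_fun_on d (params d s k) (\<lambda>x. lin_loss (s * k) x z)" for z
    unfolding convex_fun_on_def lin_loss_conv_comb[OF d] by simp
  moreover have "params d s k \<subseteq> space (euclid d)" by (auto simp: params_def)
  ultimately have "sco_problem d (params d s k, count_space ?V, lin_loss (s * k))"
    unfolding sco_problem_def prod.case using ne int params_convex[OF d]
    by (intro conjI ballI) simp_all
  then show ?thesis
    unfolding hard_problem_def l1_sco_def using params_subset_ball[OF d s] lin_loss_Lipschitz[OF d] by simp
qed

lemma integral_point_measure_coin: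
  assumes "finite J" "\<And>j. j \<in> J \<Longrightarrow> \<bar>m j\<bar> \<le> 1"
  shows "(\<integral>z. g z \<partial>point_measure (J \<rightarrow>\<^sub>E signs) (\<lambda>z. ennreal (coin J m z))) =
    (\<Sum>z\<in>J \<rightarrow>\<^sub>E signs. coin J m z * (g z :: real))"
  using assms by (subst lebesgue_integral_point_measure_finite)
    (auto intro!: finite_PiE coin_nonneg)

lemma coin_measure_prob:
  assumes "finite J" "\<And>j. j \<in> J \<Longrightarrow> \<bar>m j\<bar> \<le> 1"
  shows "point_measure (J \<rightarrow>\<^sub>E signs) (\<lambda>z. ennreal (coin J m z)) \<in> space (prob_algebra (count_space (J \<rightarrow>\<^sub>E signs)))"
proof -
  have "prob_space (point_measure (J \<rightarrow>\<^sub>E signs) (\<lambda>z. ennreal (coin J m z)))"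
  proof (rule prob_space_point_measure)
    have "(\<Sum>z\<in>J \<rightarrow>\<^sub>E signs. ennreal (coin J m z)) = ennreal (\<Sum>z\<in>J \<rightarrow>\<^sub>E signs. coin J m z)"
      using assms by (intro sum_ennreal coin_nonneg)
    then show "(\<Sum>z\<in>J \<rightarrow>\<^sub>E signs. ennreal (coin J m z)) = 1" using assms by (simp add: coin_total)
  qed (use assms in \<open>auto intro: finite_PiE\<close>)
  then show ?thesis by (simp add: space_prob_algebra sets_point_measure)
qed

lemma pop_risk_coin:
  assumes "\<And>j. j < N \<Longrightarrow> \<bar>m j\<bar> \<le> 1"
  shows "pop_risk (lin_loss N) (point_measure ({..<N} \<rightarrow>\<^sub>E signs) (\<lambda>z. ennreal (coin {..<N} m z))) x =
    - (\<Sum>j<N. x j * m j)"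
proof -
  let ?V = "{..<N} \<rightarrow>\<^sub>E signs" and ?P = "coin {..<N} m"
  have "pop_risk (lin_loss N) (point_measure ?V (\<lambda>z. ennreal (?P z))) x = (\<Sum>z\<in>?V. ?P z * lin_loss N x z)"
    unfolding pop_risk_def using assms by (intro integral_point_measure_coin) auto
  also have "\<dots> = - (\<Sum>z\<in>?V. \<Sum>j<N. x j * (?P z * z j))"
    by (simp add: lin_loss_def sum_negf sum_distrib_left mult.left_commute)
  also have "(\<Sum>z\<in>?V. \<Sum>j<N. x j * (?P z * z j)) = (\<Sum>j<N. x j * (\<Sum>z\<in>?V. ?P z * z j))"
    unfolding sum_distrib_left by (rule sum.swap)
  also have "\<dots> = (\<Sum>j<N. x j * m j)"
    by (intro sum.cong refl) (simp add: coin_mean)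
  finally show ?thesis .
qed

lemma score_measurable:
  assumes "s * k \<le> d"
  shows "(\<lambda>(\<theta>, z). score s k c m \<theta> z) \<in>
    borel_measurable (param_space d \<Theta> \<Otimes>\<^sub>M count_space ({..<s * k} \<rightarrow>\<^sub>E signs))"
proof -
  have "(\<lambda>p. fst p j) \<in> borel_measurable (param_space d \<Theta> \<Otimes>\<^sub>M count_space ({..<s * k} \<rightarrow>\<^sub>E signs))"
    if "j < s * k" for j
    unfolding param_space_def euclid_def using that assms
    by (intro measurable_compose[OF measurable_fst] measurable_restrict_space1) simp
  moreover have "(\<lambda>p. snd p j) \<in> borel_measurable (param_space d \<Theta> \<Otimes>\<^sub>M count_space ({..<s * k} \<rightarrow>\<^sub>E signs))" for j
    by (intro measurable_compose[OF measurable_snd]) simp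
  ultimately show ?thesis
    unfolding score_def split_def
    by (intro borel_measurable_sum borel_measurable_times borel_measurable_diff borel_measurable_const) auto
qed

section \<open>From total correlation to a count\<close>

text \<open>Termwise: below \<open>l\<close> the value is less than \<open>l\<close>, and otherwise
  it is at most \<open>a\<close> plus its excess over \<open>a\<close>. A counted point thus
  contributes at most \<open>a\<close> to what remains after subtracting thresholds and
  excesses.\<close>

lemma traced_count_ge:
  fixes X :: "'i \<Rightarrow> real"
  assumes "finite I" "0 < a" "0 \<le> l"
  shows "1 / a * ((\<Sum>i\<in>I. X i) - real (card I) * l - (\<Sum>i\<in>I. max 0 (X i - a))) \<le> real (card {i\<in>I. l \<le> X i})"
proof -
  have "(\<Sum>i\<in>I. X i) \<le> (\<Sum>i\<in>I. l + a * of_bool (l \<le> X i) + max 0 (X i - a))"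
    using assms by (intro sum_mono) auto
  also have "\<dots> = real (card I) * l + a * real (card {i\<in>I. l \<le> X i}) + (\<Sum>i\<in>I. max 0 (X i - a))"
    using assms(1) by (simp add: sum.distrib sum_distrib_left[symmetric] Collect_conj_eq Int_commute)
  finally have "(\<Sum>i\<in>I. X i) - real (card I) * l - (\<Sum>i\<in>I. max 0 (X i - a)) \<le> a * real (card {i\<in>I. l \<le> X i})"
    by simp
  then show ?thesis using assms(2) by (simp add: pos_divide_le_eq mult.commute)
qed

text \<open>In units of \<open>ln k / (256 * \<alpha>)\<close>, fingerprinting provides 4, the
  thresholds take at most 1 and the excesses at most 1. The remaining 2 units, divided by the cap
  \<open>a = 512 * \<alpha>\<close>, give the stated count.\<close>

lemma hard_problem_traceable:
  assumes s: "0 < s" and k: "64 \<le> k" and d: "s * k \<le> d" and n: "n \<le> s"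
    and \<alpha>: "0 < \<alpha>" "\<alpha> \<le> 1/8" and \<xi>: "0 < \<xi>" "\<xi> < 1"
    and noise: "real n * (2 * sqrt (ln (1 / \<xi>) / real s)) \<le> ln (real k) / (256 * \<alpha>)"
    and learner: "is_learner d n \<alpha> (hard_problem d s k) A"
  shows "traceable d n \<xi> (ln (real k) / (65536 * \<alpha>\<^sup>2)) (hard_problem d s k) A"
proof -
  let ?J = "{..<s * k}" and ?I = "{1..n}"
  let ?V = "?J \<rightarrow>\<^sub>E signs"
  let ?\<Theta> = "params d s k" and ?Z = "count_space ?V"
  let ?D = "\<lambda>m. point_measure ?V (\<lambda>z. ennreal (coin ?J m z))"
  let ?T = "param_space d ?\<Theta>"
  have k0: "0 < k" using k by simp
  have fV: "finite ?V" by (intro finite_PiE) auto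

  have A: "A \<in> (\<Pi>\<^sub>M i\<in>?I. ?Z) \<rightarrow>\<^sub>M prob_algebra ?T"
    using learner by (simp add: is_learner_def hard_problem_def algorithms_def)
  have AS: "prob_space (A S)" "sets (A S) = sets ?T" if "S \<in> ?I \<rightarrow>\<^sub>E ?V" for S
    using measurable_space[OF A, of S] that by (auto simp: space_prob_algebra space_PiM)
  have AS_space: "space (A S) = ?\<Theta>" if "S \<in> ?I \<rightarrow>\<^sub>E ?V" for S
    using sets_eq_imp_space_eq[OF AS(2)[OF that]]
    by (auto simp: param_space_def space_restrict_space params_def)
  have AS_feas: "feasible s k x" if "S \<in> ?I \<rightarrow>\<^sub>E ?V" "x \<in> space (A S)" for S x
    using AS_space[OF that(1)] that(2) by (simp add: params_def)
  have int: "integrable (A S) (\<lambda>x. x j)" if S: "S \<in> ?I \<rightarrow>\<^sub>E ?V" and j: "j < s * k" for S j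
  proof -
    interpret AS: prob_space "A S" using AS(1)[OF S] .
    have "(\<lambda>x. x j) \<in> borel_measurable ?T"
      unfolding param_space_def euclid_def using j d by (intro measurable_restrict_space1) simp
    then have meas: "(\<lambda>x. x j) \<in> borel_measurable (A S)"
      unfolding measurable_cong_sets[OF AS(2)[OF S] refl] .
    have "\<bar>x j\<bar> \<le> 1 / real s" if "x \<in> space (A S)" for x
      using AS_feas[OF S that] feasible_le[OF AS_feas[OF S that] k0 j] j by (simp add: feasible_def)
    then show ?thesis
      using meas by (intro AS.integrable_const_bound[where B = "1 / real s"] AE_I2) auto
  qed

  \<comment> \<open>Loss and score are linear in the parameter, so for both of them the randomised
    output may be replaced by its mean.\<close>
  define W where "W S j = (\<integral>x. x j \<partial>A S)" for S j
  have W: "feasible s k (W S)" if S: "S \<in> ?I \<rightarrow>\<^sub>E ?V" for S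
    unfolding feasible_def
  proof (intro conjI allI impI)
    interpret AS: prob_space "A S" using AS(1)[OF S] .
    fix j assume "j < s * k"
    then show "0 \<le> W S j"
      unfolding W_def using AS_feas[OF S] by (intro Bochner_Integration.integral_nonneg) (auto simp: feasible_def)
  next
    interpret AS: prob_space "A S" using AS(1)[OF S] .
    fix t assume t: "t < s"
    have "(\<Sum>j\<in>block k t. W S j) = (\<integral>x. (\<Sum>j\<in>block k t. x j) \<partial>A S)"
      unfolding W_def using int[OF S] block_subset[OF t, of k]
      by (intro Bochner_Integration.integral_sum[symmetric]) auto
    also have "\<dots> = (\<integral>x. 1 / real s \<partial>A S)"
      using AS_feas[OF S] t by (intro Bochner_Integration.integral_cong) (auto simp: feasible_def)
    finally show "(\<Sum>j\<in>block k t. W S j) = 1 / real s" by (simp add: AS.prob_space)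
  qed
  have int_lin: "integrable (A S) (\<lambda>x. \<Sum>j\<in>?J. x j * v j)"
    "(\<integral>x. (\<Sum>j\<in>?J. x j * v j) \<partial>A S) = (\<Sum>j\<in>?J. W S j * v j)" if S: "S \<in> ?I \<rightarrow>\<^sub>E ?V" for S v
  proof -
    have *: "integrable (A S) (\<lambda>x. x j * v j)" if "j \<in> ?J" for j
      using int[OF S, of j] that by (intro integrable_mult_left) auto
    then show "integrable (A S) (\<lambda>x. \<Sum>j\<in>?J. x j * v j)" by (intro Bochner_Integration.integrable_sum)
    show "(\<integral>x. (\<Sum>j\<in>?J. x j * v j) \<partial>A S) = (\<Sum>j\<in>?J. W S j * v j)"
      unfolding W_def using * by (subst Bochner_Integration.integral_sum) auto
  qed

  have guarantee: "(\<Sum>j\<in>?J. y j * m j) - \<alpha> \<le>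
      pexp ?I ?V (\<lambda>_. coin ?J m) (\<lambda>S. \<Sum>j\<in>?J. W S j * m j)"
    if m0: "\<And>j. 0 \<le> m j" and m1: "\<And>j. j < s * k \<Longrightarrow> m j \<le> 1/2" and y: "feasible s k y" for m y
  proof -
    let ?F = "pop_risk (lin_loss (s * k)) (?D m)"
    have m: "\<bar>m j\<bar> \<le> 1" if "j < s * k" for j using m0[of j] m1[OF that] by simp
    have F: "?F x = - (\<Sum>j\<in>?J. x j * m j)" for x by (rule pop_risk_coin[OF m])
    have D: "?D m \<in> space (prob_algebra ?Z)" using m by (intro coin_measure_prob) auto
    have "(\<integral>S. (\<integral>x. ?F x \<partial>A S) \<partial>(\<Pi>\<^sub>M i\<in>?I. ?D m)) - (INF x\<in>?\<Theta>. ?F x) \<le> \<alpha>"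
      using learner D by (simp add: is_learner_def hard_problem_def)
    moreover have "(\<integral>S. (\<integral>x. ?F x \<partial>A S) \<partial>(\<Pi>\<^sub>M i\<in>?I. ?D m)) =
        pexp ?I ?V (\<lambda>_. coin ?J m) (\<lambda>S. \<integral>x. ?F x \<partial>A S)"
      using fV m by (intro integral_PiM_point_measure coin_nonneg) auto
    moreover have "\<dots> = pexp ?I ?V (\<lambda>_. coin ?J m) (\<lambda>S. - 1 * (\<Sum>j\<in>?J. W S j * m j))"
      unfolding F using int_lin(2) by (intro pexp_cong) simp
    moreover have "(INF x\<in>?\<Theta>. ?F x) \<le> - (\<Sum>j\<in>?J. y j * m j)"
    proof -
      let ?e = "\<lambda>j\<in>{..<d}. if j < s * k then y j else 0"
      \<comment> \<open>The real infimum lies below each value only for a family bounded below;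
        total mass 1 and means at most 1 provide the bound.\<close>
      have "- 1 \<le> ?F x" if "x \<in> ?\<Theta>" for x
      proof -
        have x: "feasible s k x" using that by (simp add: params_def)
        have "(\<Sum>j\<in>?J. x j * m j) \<le> (\<Sum>j\<in>?J. x j * 1)"
          using x m abs_le_D1 by (intro sum_mono mult_left_mono) (auto simp: feasible_def)
        then show ?thesis using feasible_sum[OF x s] by (simp add: F)
      qed
      then have "(INF x\<in>?\<Theta>. ?F x) \<le> ?F ?e"
        using params_embed[OF y d] by (intro cINF_lower bdd_belowI2)
      also have "\<dots> = - (\<Sum>j\<in>?J. y j * m j)"
        unfolding F using d by (intro arg_cong[where f = uminus] sum.cong) auto
      finally show ?thesis .
    qed
    ultimately show ?thesis unfolding pexp_cmult by linarith
  qed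

  obtain m r where m: "\<And>j. j < s * k \<Longrightarrow> 0 \<le> m j \<and> m j \<le> 1/2"
    and r: "\<And>j. j < s * k \<Longrightarrow> 0 \<le> r j \<and> r j \<le> 1"
    and corr: "ln (real k) / (64 * \<alpha>) \<le> pexp ?I ?V (\<lambda>_. coin ?J m)
        (\<lambda>S. \<Sum>i\<in>?I. score s k (\<lambda>j. r j / (1 - (m j)\<^sup>2)) m (W S) (S i))"
    using fingerprinting[OF s k \<alpha> W guarantee] by blast
  define c where "c j = r j / (1 - (m j)\<^sup>2)" for j
  have c: "0 \<le> c j" "(c j)\<^sup>2 \<le> 2" if j: "j < s * k" for j
  proof -
    have "(m j)\<^sup>2 \<le> (1/2)\<^sup>2" using m[OF j] by (intro power_mono) auto
    then have q: "3/4 \<le> 1 - (m j)\<^sup>2" by (simp add: power2_eq_square)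
    then show c0: "0 \<le> c j" using r[OF j] by (simp add: c_def)
    have "c j \<le> 4/3" unfolding c_def using q r[OF j] by (simp add: pos_divide_le_eq)
    then have "(c j)\<^sup>2 \<le> (4/3)\<^sup>2" using c0 by (intro power_mono)
    then show "(c j)\<^sup>2 \<le> 2" by (simp add: power2_eq_square)
  qed
  interpret scoring s k c m
    using s k0 c m by unfold_locales force+

  \<comment> \<open>Solves \<open>s * l\<^sup>2 / 4 = ln (1 / \<xi>)\<close>, so that the tail bound
    is exactly \<xi>.\<close>
  define l where "l = 2 * sqrt (ln (1 / \<xi>) / real s)"
  have lxi: "0 \<le> ln (1 / \<xi>)" using \<xi> by simp
  have l0: "0 \<le> l" using lxi by (simp add: l_def)
  have exp_l: "exp (- (real s * l\<^sup>2 / 4)) = \<xi>"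
  proof -
    have "real s * l\<^sup>2 / 4 = ln (1 / \<xi>)" using lxi s by (simp add: l_def power_mult_distrib)
    then show ?thesis using \<xi> by (simp add: ln_div)
  qed
  let ?phi = "score s k c m"
  have Dm: "?D m \<in> space (prob_algebra ?Z)" using m by (intro coin_measure_prob) force+

  \<comment> \<open>Index 0 is split off the product; restricting to \<open>{1..n}\<close> discards
    it, so the output depends on \<open>S\<close> only.\<close>
  have expectation: "(\<integral>x. h x \<partial>tracing_law d n ?\<Theta> (?D m) A) =
      (\<Sum>z\<in>?V. P z * pexp ?I ?V (\<lambda>_. P) (\<lambda>S. \<integral>x. h (S(0 := z), x) \<partial>A S))"
    if h: "h \<in> borel_measurable ((\<Pi>\<^sub>M i\<in>{0..n}. ?Z) \<Otimes>\<^sub>M ?T)" "\<And>x. \<bar>h x\<bar> \<le> B" for h B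
  proof -
    have "(\<integral>x. h x \<partial>tracing_law d n ?\<Theta> (?D m) A) =
        (\<integral>z. (\<integral>x. h (z, x) \<partial>A (restrict z ?I)) \<partial>(\<Pi>\<^sub>M i\<in>{0..n}. ?D m))"
      by (rule integral_tracing_law[OF Dm A h])
    also have "\<dots> = pexp {0..n} ?V (\<lambda>_. P) (\<lambda>z. \<integral>x. h (z, x) \<partial>A (restrict z ?I))"
      using fV P_nonneg by (intro integral_PiM_point_measure) auto
    also have "{0..n} = insert 0 ?I" by auto
    also have "pexp (insert 0 ?I) ?V (\<lambda>_. P) (\<lambda>z. \<integral>x. h (z, x) \<partial>A (restrict z ?I)) =
        (\<Sum>z\<in>?V. P z * pexp ?I ?V (\<lambda>_. P) (\<lambda>S. \<integral>x. h (S(0 := z), x) \<partial>A (restrict (S(0 := z)) ?I)))"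
      using fV by (intro pexp_insert) auto
    also have "\<dots> = (\<Sum>z\<in>?V. P z * pexp ?I ?V (\<lambda>_. P) (\<lambda>S. \<integral>x. h (S(0 := z), x) \<partial>A S))"
    proof -
      have "restrict (S(0 := z)) ?I = S" if "S \<in> ?I \<rightarrow>\<^sub>E ?V" for S z
        using that by (auto simp: PiE_def extensional_def restrict_def fun_eq_iff)
      then have "pexp ?I ?V (\<lambda>_. P) (\<lambda>S. \<integral>x. h (S(0 := z), x) \<partial>A (restrict (S(0 := z)) ?I)) =
          pexp ?I ?V (\<lambda>_. P) (\<lambda>S. \<integral>x. h (S(0 := z), x) \<partial>A S)" for z
        by (intro pexp_cong) simp
      then show ?thesis by simp
    qed
    finally show ?thesis .
  qed

  have phi_meas: "(\<lambda>p. of_bool (l \<le> ?phi (snd p) (fst p i)) :: real) \<in>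
      borel_measurable ((\<Pi>\<^sub>M i\<in>{0..n}. ?Z) \<Otimes>\<^sub>M ?T)" if i: "i \<in> {0..n}" for i
  proof -
    have "(\<lambda>p. fst p i) \<in> (\<Pi>\<^sub>M i\<in>{0..n}. ?Z) \<Otimes>\<^sub>M ?T \<rightarrow>\<^sub>M ?Z"
      using i by (intro measurable_compose[OF measurable_fst] measurable_component_singleton)
    then have "(\<lambda>p. (snd p, fst p i)) \<in> (\<Pi>\<^sub>M i\<in>{0..n}. ?Z) \<Otimes>\<^sub>M ?T \<rightarrow>\<^sub>M ?T \<Otimes>\<^sub>M ?Z"
      by (intro measurable_Pair measurable_snd)
    from measurable_compose[OF this score_measurable[OF d]]
    have [measurable]: "(\<lambda>p. ?phi (snd p) (fst p i)) \<in> borel_measurable ((\<Pi>\<^sub>M i\<in>{0..n}. ?Z) \<Otimes>\<^sub>M ?T)"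
      by simp
    show ?thesis unfolding of_bool_def by measurable
  qed
  have phi_meas_AS: "(\<lambda>x. of_bool (l \<le> ?phi x z) :: real) \<in> borel_measurable (A S)"
    if S: "S \<in> ?I \<rightarrow>\<^sub>E ?V" for S z
  proof -
    have [measurable]: "(\<lambda>x. ?phi x z) \<in> borel_measurable (A S)"
      unfolding score_def by (rule borel_measurable_integrable[OF int_lin(1)[OF S]])
    show ?thesis unfolding of_bool_def by measurable
  qed

  have fresh: "\<P>((z, \<theta>) in tracing_law d n ?\<Theta> (?D m) A. l \<le> ?phi \<theta> (z 0)) \<le> \<xi>"
  proof -
    let ?M = "tracing_law d n ?\<Theta> (?D m) A"
    let ?h = "\<lambda>p. of_bool (l \<le> ?phi (snd p) (fst p 0)) :: real"
    have "\<P>((z, \<theta>) in ?M. l \<le> ?phi \<theta> (z 0)) = (\<integral>p. indicator {p. l \<le> ?phi (snd p) (fst p 0)} p \<partial>?M)"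
      by (simp add: split_def Int_def conj_commute)
    also have "\<dots> = (\<integral>p. ?h p \<partial>?M)" by (simp add: indicator_def)
    also have "\<dots> = (\<Sum>z\<in>?V. P z * pexp ?I ?V (\<lambda>_. P) (\<lambda>S. \<integral>x. of_bool (l \<le> ?phi x z) \<partial>A S))"
      using expectation[OF phi_meas[of 0], of 1] by simp
    \<comment> \<open>With the fresh point summed inside, sample and output are fixed first, and the
      tail bound for a fixed feasible vector applies.\<close>
    also have "\<dots> = pexp ?I ?V (\<lambda>_. P) (\<lambda>S. \<Sum>z\<in>?V. P z * (\<integral>x. of_bool (l \<le> ?phi x z) \<partial>A S))"
      by (simp add: pexp_sum pexp_cmult)
    also have "\<dots> \<le> pexp ?I ?V (\<lambda>_. P) (\<lambda>_. \<xi>)"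
    proof (rule pexp_mono)
      fix S assume S: "S \<in> ?I \<rightarrow>\<^sub>E ?V"
      interpret AS: prob_space "A S" using AS(1)[OF S] .
      have intb: "integrable (A S) (\<lambda>x. P z * of_bool (l \<le> ?phi x z))" for z
        using phi_meas_AS[OF S, of z]
        by (intro integrable_mult_right AS.integrable_const_bound[where B = 1] AE_I2) auto
      have "(\<Sum>z\<in>?V. P z * (\<integral>x. of_bool (l \<le> ?phi x z) \<partial>A S)) =
          (\<integral>x. (\<Sum>z\<in>?V. P z * of_bool (l \<le> ?phi x z)) \<partial>A S)"
        using intb by (subst Bochner_Integration.integral_sum) auto
      also have "\<dots> \<le> (\<integral>x. \<xi> \<partial>A S)"
        using intb score_tail[OF AS_feas[OF S] l0] unfolding exp_l
        by (intro integral_mono Bochner_Integration.integrable_sum) auto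
      finally show "(\<Sum>z\<in>?V. P z * (\<integral>x. of_bool (l \<le> ?phi x z) \<partial>A S)) \<le> \<xi>"
        by (simp add: AS.prob_space)
    qed (rule P_nonneg)
    also have "\<dots> = \<xi>" using fV P_total by (intro pexp_const) auto
    finally show ?thesis .
  qed

  \<comment> \<open>The excess bound is at most \<open>2 * ln k / a\<close>; this \<open>a\<close>
    makes it one unit \<open>ln k / (256 * \<alpha>)\<close>.\<close>
  define a where "a = 512 * \<alpha>"
  have a: "0 < a" using \<alpha> by (simp add: a_def)
  obtain G where G: "\<And>x S. feasible s k x \<Longrightarrow> (\<Sum>i\<in>?I. max 0 (?phi x (S i) - a)) \<le> G S"
    and EG: "pexp ?I ?V (\<lambda>_. P) G \<le> (real n + real s * ln (real k)) / (real s * a)"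
    using excess_bound[OF a, of n] by blast

  have traced: "ln (real k) / (65536 * \<alpha>\<^sup>2) \<le>
      (\<integral>(z, \<theta>). real (card {i\<in>?I. l \<le> ?phi \<theta> (z i)}) \<partial>tracing_law d n ?\<Theta> (?D m) A)"
  proof -
    let ?h = "\<lambda>p. real (card {i\<in>?I. l \<le> ?phi (snd p) (fst p i)})"
    have sum_h: "real (card {i\<in>?I. Q i}) = (\<Sum>i\<in>?I. of_bool (Q i))" for Q
    proof -
      have "{i\<in>?I. Q i} = ?I \<inter> {i. Q i}" by auto
      then show ?thesis by simp
    qed
    have h_meas: "?h \<in> borel_measurable ((\<Pi>\<^sub>M i\<in>{0..n}. ?Z) \<Otimes>\<^sub>M ?T)"
      unfolding sum_h by (intro borel_measurable_sum phi_meas) auto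
    have h_bound: "\<bar>?h p\<bar> \<le> real n" for p
    proof -
      have "card {i\<in>?I. l \<le> ?phi (snd p) (fst p i)} \<le> card ?I" by (intro card_mono) auto
      then show ?thesis by simp
    qed
    have eq: "(\<integral>(z, \<theta>). real (card {i\<in>?I. l \<le> ?phi \<theta> (z i)}) \<partial>tracing_law d n ?\<Theta> (?D m) A) =
        pexp ?I ?V (\<lambda>_. P) (\<lambda>S. \<integral>x. real (card {i\<in>?I. l \<le> ?phi x (S i)}) \<partial>A S)"
    proof -
      have *: "{i\<in>?I. l \<le> ?phi x ((S(0 := z)) i)} = {i\<in>?I. l \<le> ?phi x (S i)}" for x S z
        by auto
      have "(\<integral>(z, \<theta>). real (card {i\<in>?I. l \<le> ?phi \<theta> (z i)}) \<partial>tracing_law d n ?\<Theta> (?D m) A) =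
          (\<Sum>z\<in>?V. P z * pexp ?I ?V (\<lambda>_. P) (\<lambda>S. \<integral>x. ?h (S(0 := z), x) \<partial>A S))"
        unfolding split_def by (rule expectation[OF h_meas h_bound])
      then show ?thesis by (simp only: fst_conv snd_conv * sum_distrib_right[symmetric] P_total mult_1)
    qed
    \<comment> \<open>The count is not linear in the output, so the termwise bound is applied to
      every output before averaging; only its affine lower bound is then expressed through
      \<open>W\<close>. \<open>G S\<close> is the same for all outputs and passes through the
      average.\<close>
    have "pexp ?I ?V (\<lambda>_. P) (\<lambda>S. 1 / a * ((\<Sum>i\<in>?I. ?phi (W S) (S i)) - real n * l - G S)) \<le>
        pexp ?I ?V (\<lambda>_. P) (\<lambda>S. \<integral>x. real (card {i\<in>?I. l \<le> ?phi x (S i)}) \<partial>A S)"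
    proof (rule pexp_mono)
      fix S assume S: "S \<in> ?I \<rightarrow>\<^sub>E ?V"
      interpret AS: prob_space "A S" using AS(1)[OF S] .
      have int_phi: "integrable (A S) (\<lambda>x. ?phi x z)" "(\<integral>x. ?phi x z \<partial>A S) = ?phi (W S) z" for z
        unfolding score_def by (rule int_lin[OF S])+
      have int1: "integrable (A S) (\<lambda>x. 1 / a * ((\<Sum>i\<in>?I. ?phi x (S i)) - real n * l - G S))"
        using int_phi(1) by (intro integrable_mult_right Bochner_Integration.integrable_diff
          Bochner_Integration.integrable_sum) auto
      have "1 / a * ((\<Sum>i\<in>?I. ?phi (W S) (S i)) - real n * l - G S) =
          (\<integral>x. 1 / a * ((\<Sum>i\<in>?I. ?phi x (S i)) - real n * l - G S) \<partial>A S)"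
        using int_phi by (simp add: Bochner_Integration.integral_diff Bochner_Integration.integral_sum AS.prob_space)
      also have "\<dots> \<le> (\<integral>x. real (card {i\<in>?I. l \<le> ?phi x (S i)}) \<partial>A S)"
      proof (rule integral_mono[OF int1])
        show "integrable (A S) (\<lambda>x. real (card {i\<in>?I. l \<le> ?phi x (S i)}))"
          unfolding sum_h using phi_meas_AS[OF S]
          by (intro Bochner_Integration.integrable_sum AS.integrable_const_bound[where B = 1] AE_I2) auto
      next
        fix x assume x: "x \<in> space (A S)"
        have "1 / a * ((\<Sum>i\<in>?I. ?phi x (S i)) - real n * l - G S) \<le>
            1 / a * ((\<Sum>i\<in>?I. ?phi x (S i)) - real (card ?I) * l - (\<Sum>i\<in>?I. max 0 (?phi x (S i) - a)))"
          using G[OF AS_feas[OF S x], of S] a by (intro mult_left_mono) auto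
        also have "\<dots> \<le> real (card {i\<in>?I. l \<le> ?phi x (S i)})"
          by (rule traced_count_ge) (use a l0 in auto)
        finally show "1 / a * ((\<Sum>i\<in>?I. ?phi x (S i)) - real n * l - G S) \<le>
            real (card {i\<in>?I. l \<le> ?phi x (S i)})" .
      qed
      finally show "1 / a * ((\<Sum>i\<in>?I. ?phi (W S) (S i)) - real n * l - G S) \<le>
        (\<integral>x. real (card {i\<in>?I. l \<le> ?phi x (S i)}) \<partial>A S)" .
    qed (rule P_nonneg)
    moreover have "pexp ?I ?V (\<lambda>_. P) (\<lambda>S. 1 / a * ((\<Sum>i\<in>?I. ?phi (W S) (S i)) - real n * l - G S)) =
        1 / a * (pexp ?I ?V (\<lambda>_. P) (\<lambda>S. \<Sum>i\<in>?I. ?phi (W S) (S i)) - real n * l - pexp ?I ?V (\<lambda>_. P) G)"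
      unfolding pexp_cmult pexp_diff using fV P_total by (subst pexp_const) auto
    moreover have "1 / a * (ln (real k) / (128 * \<alpha>)) \<le>
        1 / a * (pexp ?I ?V (\<lambda>_. P) (\<lambda>S. \<Sum>i\<in>?I. ?phi (W S) (S i)) - real n * l - pexp ?I ?V (\<lambda>_. P) G)"
    proof (rule mult_left_mono)
      have "1 \<le> ln (real k)"
      proof -
        have "3 \<le> real k" using \<open>64 \<le> k\<close> by simp
        then have "exp 1 \<le> real k" using exp_le by linarith
        then show ?thesis using k0 by (simp add: ln_ge_iff)
      qed
      then have "real n \<le> real s * ln (real k)"
        using n mult_left_mono[of 1 "ln (real k)" "real s"] by simp
      then have "(real n + real s * ln (real k)) / (real s * a) \<le> (2 * (real s * ln (real k))) / (real s * a)"
        using s a by (intro divide_right_mono) auto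
      also have "\<dots> = ln (real k) / (256 * \<alpha>)" using s by (simp add: a_def)
      finally have "pexp ?I ?V (\<lambda>_. P) G \<le> ln (real k) / (256 * \<alpha>)" using EG by linarith
      moreover have "real n * l \<le> ln (real k) / (256 * \<alpha>)" using noise by (simp add: l_def)
      moreover have "ln (real k) / (64 * \<alpha>) \<le> pexp ?I ?V (\<lambda>_. P) (\<lambda>S. \<Sum>i\<in>?I. ?phi (W S) (S i))"
        using corr unfolding c_def .
      moreover have "ln (real k) / (64 * \<alpha>) = 4 * (ln (real k) / (256 * \<alpha>))"
        "ln (real k) / (128 * \<alpha>) = 2 * (ln (real k) / (256 * \<alpha>))" by simp_all
      ultimately show "ln (real k) / (128 * \<alpha>) \<le>
        pexp ?I ?V (\<lambda>_. P) (\<lambda>S. \<Sum>i\<in>?I. ?phi (W S) (S i)) - real n * l - pexp ?I ?V (\<lambda>_. P) G"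
        by linarith
    qed (use a in simp)
    moreover have "1 / a * (ln (real k) / (128 * \<alpha>)) = ln (real k) / (65536 * \<alpha>\<^sup>2)"
      by (simp add: a_def power2_eq_square)
    ultimately show ?thesis unfolding eq by linarith
  qed

  have "is_tracer d (hard_problem d s k) ?phi (?D m)"
    using score_measurable[OF d, of c m ?\<Theta>] Dm by (simp add: is_tracer_def hard_problem_def)
  then show ?thesis
    unfolding traceable_def hard_problem_def using \<xi> fresh traced by auto
qed

section \<open>Choice of the dimensions\<close>

text \<open>\<open>k\<close> is about \<open>d powr 0.01\<close> and \<open>s\<close> about
  \<open>d powr 0.99\<close>; the exponents 0.005 and 0.98 absorb the rounding, and 0.98 is twice
  0.49. The bound 102400 is \<open>512 / 0.005\<close>.\<close>

lemma block_dimensions: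
  obtains d0 :: nat where
    "\<And>d. d \<ge> d0 \<Longrightarrow> \<exists>s k. 64 \<le> k \<and> s * k \<le> d \<and> real d powr 0.98 \<le> real s \<and>
      0.005 * ln (real d) \<le> ln (real k) \<and> 512 \<le> ln (real k) \<and> 1 \<le> ln (real d)"
proof -
  have "eventually (\<lambda>d::nat. 65 \<le> real d powr 0.01 \<and> real d powr 0.005 \<le> real d powr 0.01 - 1 \<and>
      real d powr 0.98 \<le> real d powr 0.99 - 1 \<and> 102400 \<le> ln (real d)) at_top"
    by (intro eventually_conj; real_asymp)
  then obtain d0 where d0: "\<And>d. d \<ge> d0 \<Longrightarrow> 65 \<le> real d powr 0.01 \<and>
      real d powr 0.005 \<le> real d powr 0.01 - 1 \<and>
      real d powr 0.98 \<le> real d powr 0.99 - 1 \<and> 102400 \<le> ln (real d)"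
    unfolding eventually_sequentially by blast
  show thesis
  proof (rule that[of d0])
    fix d assume "d0 \<le> d"
    note h = d0[OF this]
    have d: "0 < real d" using h by (cases "d = 0") auto
    define k where "k = nat \<lfloor>real d powr 0.01\<rfloor>"
    define s where "s = d div k"
    have k: "real k \<le> real d powr 0.01" "real d powr 0.01 - 1 \<le> real k" "64 \<le> k"
      using h unfolding k_def by linarith+
    have k0: "0 < real k" using k by simp
    have "ln (real d powr 0.005) \<le> ln (real k)"
      using h k d by (intro ln_mono) auto
    then have lnk: "0.005 * ln (real d) \<le> ln (real k)" using d by (simp add: ln_powr)
    have "real d powr 0.99 = real d / real d powr 0.01"
      using d powr_diff[of "real d" 1 "0.01"] by simp
    also have "\<dots> \<le> real d / real k" using d k k0 by (intro divide_left_mono) auto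
    also have "\<dots> \<le> real s + 1"
      using floor_divide_of_nat_eq[of d k, where ?'a = real] real_of_int_floor_add_one_ge[of "real d / real k"]
      by (simp add: s_def)
    finally have "real d powr 0.98 \<le> real s" using h by linarith
    then show "\<exists>s k. 64 \<le> k \<and> s * k \<le> d \<and> real d powr 0.98 \<le> real s \<and>
      0.005 * ln (real d) \<le> ln (real k) \<and> 512 \<le> ln (real k) \<and> 1 \<le> ln (real d)"
      using k lnk h by (intro exI[of _ s] exI[of _ k]) (auto simp: s_def)
  qed
qed

theorem theorem2p6:
  "\<exists>c>0. \<exists>c'>0. \<exists>d0::nat. \<forall>(d::nat) (n::nat) (\<xi>::real) (\<alpha>::real).
     d \<ge> d0 \<longrightarrow> n \<ge> 1 \<longrightarrow> 0 < \<xi> \<longrightarrow> \<xi> < 1 / exp 1 \<longrightarrow> 0 < \<alpha> \<longrightarrow>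
     c * sqrt (ln (real d) / real n) \<le> \<alpha> \<longrightarrow>
     \<alpha> \<le> min (c * (real d powr 0.49 / (real n * sqrt (ln (1 / \<xi>))))) (1 / 8) \<longrightarrow>
     (\<exists>P :: (nat \<Rightarrow> real) sco. P \<in> l1_sco d \<and>
        (\<forall>A. is_learner d n \<alpha> P A \<longrightarrow>
           (\<exists>m. m \<ge> c' * ln (real d) / \<alpha>\<^sup>2 \<and> traceable d n \<xi> m P A)))"
proof -
  obtain d0 :: nat where d0:
    "\<And>d. d \<ge> d0 \<Longrightarrow> \<exists>s k. 64 \<le> k \<and> s * k \<le> d \<and> real d powr 0.98 \<le> real s \<and>
      0.005 * ln (real d) \<le> ln (real k) \<and> 512 \<le> ln (real k) \<and> 1 \<le> ln (real d)"
    by (rule block_dimensions) blast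
  have main: "\<exists>P :: (nat \<Rightarrow> real) sco. P \<in> l1_sco d \<and> (\<forall>A. is_learner d n \<alpha> P A \<longrightarrow>
           (\<exists>m. m \<ge> 0.005 / 65536 * ln (real d) / \<alpha>\<^sup>2 \<and> traceable d n \<xi> m P A))"
    if d: "d \<ge> d0" and n: "n \<ge> 1" and \<xi>: "0 < \<xi>" "\<xi> < 1 / exp 1" and \<alpha>: "0 < \<alpha>" "\<alpha> \<le> 1/8"
      and lower: "sqrt (ln (real d) / real n) \<le> \<alpha>"
      and upper: "\<alpha> \<le> real d powr 0.49 / (real n * sqrt (ln (1 / \<xi>)))"
    for d n :: nat and \<xi> \<alpha> :: real
  proof -
    obtain s k where k: "64 \<le> k" and sk: "s * k \<le> d" and s_ge: "real d powr 0.98 \<le> real s"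
      and lnk: "0.005 * ln (real d) \<le> ln (real k)" "512 \<le> ln (real k)" and lnd: "1 \<le> ln (real d)"
      using d0[OF d] by blast
    have d_pos: "0 < real d" using lnd by (cases "d = 0") auto
    have n_pos: "0 < real n" using n by simp
    have dn: "0 < real d powr 0.98" using d_pos by simp
    have s: "0 < s" using s_ge dn by (cases "s = 0") auto
    have sqrt_s: "real d powr 0.49 \<le> sqrt (real s)"
    proof -
      have "(real d powr 0.49)\<^sup>2 = real d powr 0.98"
        using d_pos by (simp add: powr_powr[symmetric] power2_eq_square powr_add[symmetric])
      then show ?thesis using s_ge by (intro real_le_rsqrt) simp
    qed
    have "exp 1 < 1 / \<xi>" using \<xi> by (simp add: field_simps)
    then have lxi: "1 \<le> ln (1 / \<xi>)" using \<xi> by (simp add: ln_ge_iff)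
    have sq_lxi: "1 \<le> sqrt (ln (1 / \<xi>))" using lxi by simp

    have "\<alpha> * (real n * sqrt (ln (1 / \<xi>))) \<le> real d powr 0.49"
      using upper n_pos sq_lxi by (simp add: pos_le_divide_eq)
    then have up: "\<alpha> * real n * sqrt (ln (1 / \<xi>)) \<le> sqrt (real s)" using sqrt_s by (simp add: mult.assoc)

    \<comment> \<open>The lower bound on \<alpha> and \<open>ln d \<ge> 1\<close> give
      \<open>sqrt n \<le> \<alpha> * n\<close>; since \<open>sqrt (ln (1 / \<xi>)) \<ge> 1\<close>,
      the upper bound on \<alpha> turns this into \<open>sqrt n \<le> sqrt s\<close>.\<close>
    have n_le: "n \<le> s"
    proof -
      have "1 / sqrt (real n) \<le> sqrt (ln (real d) / real n)"
        using lnd n_pos by (simp add: real_sqrt_divide divide_right_mono)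
      then have "1 / sqrt (real n) \<le> \<alpha>" using lower by linarith
      then have "1 / sqrt (real n) * real n \<le> \<alpha> * real n" by (intro mult_right_mono) auto
      also have "1 / sqrt (real n) * real n = sqrt (real n)"
        using n_pos by (simp add: real_div_sqrt)
      also have "\<alpha> * real n \<le> \<alpha> * real n * sqrt (ln (1 / \<xi>))"
        using sq_lxi \<alpha> mult_left_mono[of 1 "sqrt (ln (1 / \<xi>))" "\<alpha> * real n"] by simp
      finally have "sqrt (real n) \<le> sqrt (real s)" using up by linarith
      then show ?thesis by simp
    qed
    \<comment> \<open>Multiplied by \<alpha>, the left side is at most 2 by the upper bound on
      \<alpha>, and \<open>2 = 512 / 256\<close>.\<close>
    have noise: "real n * (2 * sqrt (ln (1 / \<xi>) / real s)) \<le> ln (real k) / (256 * \<alpha>)"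
    proof -
      have "real n * (2 * sqrt (ln (1 / \<xi>) / real s)) * \<alpha> = 2 * (\<alpha> * real n * sqrt (ln (1 / \<xi>)) / sqrt (real s))"
        by (simp add: real_sqrt_divide)
      also have "\<dots> \<le> 2 * 1" using up s by (intro mult_left_mono) (auto simp: pos_divide_le_eq)
      also have "\<dots> \<le> ln (real k) / 256" using lnk by simp
      finally show ?thesis using \<alpha> by (simp add: field_simps)
    qed
    have "ln (real k) / (65536 * \<alpha>\<^sup>2) \<ge> 0.005 / 65536 * ln (real d) / \<alpha>\<^sup>2"
      using lnk \<alpha> divide_right_mono[OF lnk(1), of "65536 * \<alpha>\<^sup>2"] by simp
    moreover have "\<xi> < 1"
    proof -
      have "1 / exp (1::real) \<le> 1" by simp
      then show ?thesis using \<xi> by linarith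
    qed
    ultimately show ?thesis
      using hard_problem_l1_sco[OF s _ sk] hard_problem_traceable[OF s k sk n_le \<alpha> \<xi>(1) _ noise] k
      by (intro exI[of _ "hard_problem d s k"]) auto
  qed
  \<comment> \<open>Both bounds on \<alpha> are taken with \<open>c = 1\<close>. In
    \<open>c'\<close>, the numerator bounds the ratio of \<open>ln k\<close> to \<open>ln d\<close>
    from below, and \<open>65536 = 128 * 512\<close>.\<close>
  show ?thesis
    by (intro exI[of _ "1::real"] exI[of _ "0.005 / 65536 :: real"] exI[of _ d0] conjI allI impI main)
      simp_all
qed

end
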